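(* Let $\mathcal E$ be an essentially small idempotent-complete exact category with enough projective objects, and let $I$ be a finite-sum admissible cogenerator of $\mathcal E$. Then $$\operatorname{ddell}_{\mathcal E}I\le\operatorname{gddell}(\mathcal E)\le\operatorname{ddell}_{\mathcal E}I+1 .$$ Consequently, the following are equivalent: (1) $\operatorname{ddell}_{\mathcal E}I<\infty$; (2) $\operatorname{gddell}(\mathcal E)<\infty$; (3) $\operatorname{Fddell}(\mathcal E)=\mathcal E$.
   Context: An object $I\in\mathcal E$ is a finite-sum admissible cogenerator if for every $X\in\mathcal E$ there are an integer $r\ge1$ and an inflation $X\hookrightarrow I^{\oplus r}$. $\operatorname{gddell}(\mathcal E)=\sup\{\operatorname{ddell}_{\mathcal E}X\mid X\in\mathcal E\}$ and $\operatorname{Fddell}(\mathcal E)=\{X\in\mathcal E\mid\operatorname{ddell}_{\mathcal E}X<\infty\}$. Short exact sequences of the exact structure are called conflations; the first map of a conflation is an inflation. For each $X\in\mathcal E$ fix a conflation $0\to\Omega_{\mathcal E}X\to P_X\to X\to0$ with $P_X$ projective. The stable category $\underline{\mathcal E}=\mathcal E/[\operatorname{Proj}\mathcal E]$ has morphisms modulo those factoring through projectives, and $\Omega_{\mathcal E}$ is an endofunctor of it. $X$ is a stable retract of $Y$ if there are $u:X\to Y$, $v:Y\to X$ in $\underline{\mathcal E}$ with $vu=1_X$. For $k\ge1$, $$k\text{-}\operatorname{dell}_{\mathcal E}X=\inf\{n\ge0\mid \Omega_{\mathcal E}^nX\text{ is a stable retract of }\Omega_{\mathcal E}^{n+k}Y\text{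 for some }Y\in\mathcal E\}.$$ A sequence $0\to C_t\to\cdots\to C_0\to X\to0$ is admissibly exact if there are objects $Z_0=X,Z_1,\dots,Z_t=C_t$ and conflations $0\to Z_{i+1}\to C_i\to Z_i\to0$ for $0\le i<t$ from which it is spliced (for $t=0$: $C_0\to X$ is an isomorphism). $k\text{-}\operatorname{ddell}_{\mathcal E}X$ is the infimum of the integers $m\ge0$ such that there are $0\le t\le m$ and an admissibly exact sequence $0\to C_t\to\cdots\to C_0\to X\to0$ with $(i+k)\text{-}\operatorname{dell}_{\mathcal E}C_i\le m-i$ for $0\le i\le t$. ($\inf\emptyset=\infty$.) $\operatorname{ddell}_{\mathcal E}$ means $1\text{-}\operatorname{ddell}_{\mathcal E}$. *)

theory Defs
  imports "HOL-Algebra.Coset" "HOL-Algebra.FiniteProduct" "HOL-Library.Extended_Nat"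
begin

section \<open>Categories\<close>

text \<open>
  A category is a record whose objects form a set of the type \<open>'o\<close> and whose arrows form a set
  of the type \<open>'m\<close>. It is therefore always small; an essentially small category is represented
  by an equivalent small one. Composition and the additive structure are total functions, but
  are only constrained on arrows with matching end points.
\<close>

record ('o, 'm) cat =
  obj :: "'o set"
  arr :: "'m set"
  src :: "'m \<Rightarrow> 'o"
  tgt :: "'m \<Rightarrow> 'o"
  ident :: "'o \<Rightarrow> 'm"
  cmp :: "'m \<Rightarrow> 'm \<Rightarrow> 'm"  (infixr "\<cdot>\<index>" 70)

definition homs :: "('o, 'm, 'z) cat_scheme \<Rightarrow> 'o \<Rightarrow> 'o \<Rightarrow> 'm set" where
  "homs C X Y = {f \<in> arr C. src C f = X \<and> tgt C f = Y}"

locale category =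
  fixes C :: "('o, 'm, 'z) cat_scheme" (structure)
  assumes src_obj: "f \<in> arr C \<Longrightarrow> src C f \<in> obj C"
    and tgt_obj: "f \<in> arr C \<Longrightarrow> tgt C f \<in> obj C"
    and ident_homs: "X \<in> obj C \<Longrightarrow> ident C X \<in> homs C X X"
    and cmp_homs: "\<lbrakk>f \<in> homs C X Y; g \<in> homs C Y Z\<rbrakk> \<Longrightarrow> g \<cdot> f \<in> homs C X Z"
    and cmp_ident_right: "f \<in> homs C X Y \<Longrightarrow> f \<cdot> ident C X = f"
    and cmp_ident_left: "f \<in> homs C X Y \<Longrightarrow> ident C Y \<cdot> f = f"
    and cmp_assoc: "\<lbrakk>f \<in> homs C W X; g \<in> homs C X Y; h \<in> homs C Y Z\<rbrakk>
                      \<Longrightarrow> (h \<cdot> g) \<cdot> f = h \<cdot> (g \<cdot> f)"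

definition is_iso :: "('o, 'm, 'z) cat_scheme \<Rightarrow> 'm \<Rightarrow> bool" where
  "is_iso C f \<longleftrightarrow> f \<in> arr C \<and>
     (\<exists>g \<in> homs C (tgt C f) (src C f).
        g \<cdot>\<^bsub>C\<^esub> f = ident C (src C f) \<and> f \<cdot>\<^bsub>C\<^esub> g = ident C (tgt C f))"

definition is_retract :: "('o, 'm, 'z) cat_scheme \<Rightarrow> 'o \<Rightarrow> 'o \<Rightarrow> bool" where
  "is_retract C X Y \<longleftrightarrow>
     (\<exists>u \<in> homs C X Y. \<exists>v \<in> homs C Y X. v \<cdot>\<^bsub>C\<^esub> u = ident C X)"

definition idempotent_complete :: "('o, 'm, 'z) cat_scheme \<Rightarrow> bool" where
  "idempotent_complete C \<longleftrightarrow>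
     (\<forall>X \<in> obj C. \<forall>e \<in> homs C X X. e \<cdot>\<^bsub>C\<^esub> e = e \<longrightarrow>
        (\<exists>Y \<in> obj C. \<exists>r \<in> homs C X Y. \<exists>s \<in> homs C Y X.
           s \<cdot>\<^bsub>C\<^esub> r = e \<and> r \<cdot>\<^bsub>C\<^esub> s = ident C Y))"

definition is_pushout ::
    "('o, 'm, 'z) cat_scheme \<Rightarrow> 'm \<Rightarrow> 'm \<Rightarrow> 'm \<Rightarrow> 'm \<Rightarrow> bool" where
  \<comment> \<open>the square \<open>f' \<cdot> i = i' \<cdot> f\<close> is a pushout of the span \<open>(i, f)\<close>\<close>
  "is_pushout C i f i' f' \<longleftrightarrow>
     i \<in> arr C \<and> f \<in> homs C (src C i) (tgt C f) \<and>
     i' \<in> homs C (tgt C f) (tgt C i') \<and> f' \<in> homs C (tgt C i) (tgt C i') \<and>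
     f' \<cdot>\<^bsub>C\<^esub> i = i' \<cdot>\<^bsub>C\<^esub> f \<and>
     (\<forall>T \<in> obj C. \<forall>a \<in> homs C (tgt C i) T. \<forall>b \<in> homs C (tgt C f) T.
        a \<cdot>\<^bsub>C\<^esub> i = b \<cdot>\<^bsub>C\<^esub> f \<longrightarrow>
        (\<exists>!h. h \<in> homs C (tgt C i') T \<and> h \<cdot>\<^bsub>C\<^esub> f' = a \<and> h \<cdot>\<^bsub>C\<^esub> i' = b))"

definition is_pullback ::
    "('o, 'm, 'z) cat_scheme \<Rightarrow> 'm \<Rightarrow> 'm \<Rightarrow> 'm \<Rightarrow> 'm \<Rightarrow> bool" where
  \<comment> \<open>the square \<open>p \<cdot> f' = f \<cdot> p'\<close> is a pullback of the cospan \<open>(p, f)\<close>\<close>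
  "is_pullback C p f p' f' \<longleftrightarrow>
     p \<in> arr C \<and> f \<in> homs C (src C f) (tgt C p) \<and>
     p' \<in> homs C (src C p') (src C f) \<and> f' \<in> homs C (src C p') (src C p) \<and>
     p \<cdot>\<^bsub>C\<^esub> f' = f \<cdot>\<^bsub>C\<^esub> p' \<and>
     (\<forall>T \<in> obj C. \<forall>a \<in> homs C T (src C p). \<forall>b \<in> homs C T (src C f).
        p \<cdot>\<^bsub>C\<^esub> a = f \<cdot>\<^bsub>C\<^esub> b \<longrightarrow>
        (\<exists>!h. h \<in> homs C T (src C p') \<and> f' \<cdot>\<^bsub>C\<^esub> h = a \<and> p' \<cdot>\<^bsub>C\<^esub> h = b))"


section \<open>Additive categories\<close>

record ('o, 'm) add_cat = "('o, 'm) cat" +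
  plus_arr :: "'m \<Rightarrow> 'm \<Rightarrow> 'm"
  zero_arr :: "'o \<Rightarrow> 'o \<Rightarrow> 'm"

text \<open>The additive group of arrows, in the multiplicative notation of \<open>monoid\<close> records.\<close>

definition hom_group :: "('o, 'm, 'z) add_cat_scheme \<Rightarrow> 'o \<Rightarrow> 'o \<Rightarrow> 'm monoid" where
  "hom_group C X Y =
     \<lparr>carrier = homs C X Y, monoid.mult = plus_arr C, one = zero_arr C X Y\<rparr>"

locale preadditive_category = category C
  for C :: "('o, 'm, 'z) add_cat_scheme" (structure) +
  assumes hom_comm_group:
      "\<lbrakk>X \<in> obj C; Y \<in> obj C\<rbrakk> \<Longrightarrow> comm_group (hom_group C X Y)"
    and cmp_plus_right: "\<lbrakk>f \<in> homs C X Y; f' \<in> homs C X Y; g \<in> homs C Y Z\<rbrakk>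
      \<Longrightarrow> g \<cdot> plus_arr C f f' = plus_arr C (g \<cdot> f) (g \<cdot> f')"
    and cmp_plus_left: "\<lbrakk>f \<in> homs C X Y; g \<in> homs C Y Z; g' \<in> homs C Y Z\<rbrakk>
      \<Longrightarrow> plus_arr C g g' \<cdot> f = plus_arr C (g \<cdot> f) (g' \<cdot> f)"

text \<open>
  \<open>S\<close> is the biproduct of \<open>X 0, \<dots>, X (n - 1)\<close>, with injections \<open>inc j\<close> and projections
  \<open>prj j\<close>. For \<open>n = 0\<close> the last equation reads \<open>0 = 1\<close>, i.e. \<open>S\<close> is a zero object.
\<close>

definition is_direct_sum ::
    "('o, 'm, 'z) add_cat_scheme \<Rightarrow> nat \<Rightarrow> (nat \<Rightarrow> 'o) \<Rightarrow> 'o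
      \<Rightarrow> (nat \<Rightarrow> 'm) \<Rightarrow> (nat \<Rightarrow> 'm) \<Rightarrow> bool" where
  "is_direct_sum C n X S inc prj \<longleftrightarrow>
     S \<in> obj C \<and>
     (\<forall>j<n. inc j \<in> homs C (X j) S \<and> prj j \<in> homs C S (X j)) \<and>
     (\<forall>j<n. \<forall>k<n. prj j \<cdot>\<^bsub>C\<^esub> inc k =
        (if j = k then ident C (X j) else zero_arr C (X k) (X j))) \<and>
     finprod (hom_group C S S) (\<lambda>j. inc j \<cdot>\<^bsub>C\<^esub> prj j) {..<n} = ident C S"

locale additive_category = preadditive_category C
  for C :: "('o, 'm, 'z) add_cat_scheme" (structure) +
  assumes direct_sums_exist:
    "(\<And>j. j < n \<Longrightarrow> X j \<in> obj C) \<Longrightarrow> \<exists>S inc prj. is_direct_sum C n X S inc prj"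

definition is_kernel :: "('o, 'm, 'z) add_cat_scheme \<Rightarrow> 'm \<Rightarrow> 'm \<Rightarrow> bool" where
  \<comment> \<open>\<open>i\<close> is a kernel of \<open>p\<close>\<close>
  "is_kernel C i p \<longleftrightarrow>
     i \<in> arr C \<and> p \<in> arr C \<and> tgt C i = src C p \<and>
     p \<cdot>\<^bsub>C\<^esub> i = zero_arr C (src C i) (tgt C p) \<and>
     (\<forall>T \<in> obj C. \<forall>f \<in> homs C T (src C p). p \<cdot>\<^bsub>C\<^esub> f = zero_arr C T (tgt C p) \<longrightarrow>
        (\<exists>!g. g \<in> homs C T (src C i) \<and> i \<cdot>\<^bsub>C\<^esub> g = f))"

definition is_cokernel :: "('o, 'm, 'z) add_cat_scheme \<Rightarrow> 'm \<Rightarrow> 'm \<Rightarrow> bool" where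
  \<comment> \<open>\<open>p\<close> is a cokernel of \<open>i\<close>\<close>
  "is_cokernel C p i \<longleftrightarrow>
     i \<in> arr C \<and> p \<in> arr C \<and> tgt C i = src C p \<and>
     p \<cdot>\<^bsub>C\<^esub> i = zero_arr C (src C i) (tgt C p) \<and>
     (\<forall>T \<in> obj C. \<forall>f \<in> homs C (tgt C i) T. f \<cdot>\<^bsub>C\<^esub> i = zero_arr C (src C i) T \<longrightarrow>
        (\<exists>!g. g \<in> homs C (tgt C p) T \<and> g \<cdot>\<^bsub>C\<^esub> p = f))"


section \<open>Exact categories\<close>

text \<open>
  The field \<open>confl\<close> holds the conflations \<open>0 \<rightarrow> A \<rightarrow> B \<rightarrow> D \<rightarrow> 0\<close>, as pairs consisting of the
  inflation \<open>A \<rightarrow> B\<close> and the deflation \<open>B \<rightarrow> D\<close>.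
\<close>

record ('o, 'm) exact_cat = "('o, 'm) add_cat" +
  confl :: "('m \<times> 'm) set"

definition is_inflation :: "('o, 'm, 'z) exact_cat_scheme \<Rightarrow> 'm \<Rightarrow> bool" where
  "is_inflation E i \<longleftrightarrow> (\<exists>p. (i, p) \<in> confl E)"

definition is_deflation :: "('o, 'm, 'z) exact_cat_scheme \<Rightarrow> 'm \<Rightarrow> bool" where
  "is_deflation E p \<longleftrightarrow> (\<exists>i. (i, p) \<in> confl E)"

text \<open>Quillen's axioms, in the formulation of Buehler's survey \<open>Exact categories\<close>.\<close>

locale exact_category = additive_category E
  for E :: "('o, 'm, 'z) exact_cat_scheme" (structure) +
  assumes confl_kernel: "(i, p) \<in> confl E \<Longrightarrow> is_kernel E i p"
    and confl_cokernel: "(i, p) \<in> confl E \<Longrightarrow> is_cokernel E p i"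
    and confl_iso_closed:
      "\<lbrakk>(i, p) \<in> confl E; is_kernel E i' p'; is_cokernel E p' i';
        is_iso E a; is_iso E b; is_iso E c;
        a \<in> homs E (src E i) (src E i'); b \<in> homs E (tgt E i) (tgt E i');
        c \<in> homs E (tgt E p) (tgt E p');
        b \<cdot> i = i' \<cdot> a; c \<cdot> p = p' \<cdot> b\<rbrakk> \<Longrightarrow> (i', p') \<in> confl E"
    and ident_inflation: "X \<in> obj E \<Longrightarrow> is_inflation E (ident E X)"
    and ident_deflation: "X \<in> obj E \<Longrightarrow> is_deflation E (ident E X)"
    and inflation_cmp: "\<lbrakk>is_inflation E i; is_inflation E j; tgt E i = src E j\<rbrakk>
      \<Longrightarrow> is_inflation E (j \<cdot> i)"
    and deflation_cmp: "\<lbrakk>is_deflation E p; is_deflation E q; tgt E p = src E q\<rbrakk>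
      \<Longrightarrow> is_deflation E (q \<cdot> p)"
    and inflation_pushout: "\<lbrakk>is_inflation E i; f \<in> arr E; src E f = src E i\<rbrakk>
      \<Longrightarrow> \<exists>i' f'. is_pushout E i f i' f' \<and> is_inflation E i'"
    and deflation_pullback: "\<lbrakk>is_deflation E p; f \<in> arr E; tgt E f = tgt E p\<rbrakk>
      \<Longrightarrow> \<exists>p' f'. is_pullback E p f p' f' \<and> is_deflation E p'"

definition is_projective :: "('o, 'm, 'z) exact_cat_scheme \<Rightarrow> 'o \<Rightarrow> bool" where
  "is_projective E P \<longleftrightarrow> P \<in> obj E \<and>
     (\<forall>p f. is_deflation E p \<longrightarrow> f \<in> homs E P (tgt E p) \<longrightarrow>
        (\<exists>g \<in> homs E P (src E p). p \<cdot>\<^bsub>E\<^esub> g = f))"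

definition enough_projectives :: "('o, 'm, 'z) exact_cat_scheme \<Rightarrow> bool" where
  "enough_projectives E \<longleftrightarrow>
     (\<forall>X \<in> obj E. \<exists>P p. is_projective E P \<and> p \<in> homs E P X \<and> is_deflation E p)"

definition finite_sum_admissible_cogenerator ::
    "('o, 'm, 'z) exact_cat_scheme \<Rightarrow> 'o \<Rightarrow> bool" where
  "finite_sum_admissible_cogenerator E I \<longleftrightarrow> I \<in> obj E \<and>
     (\<forall>X \<in> obj E. \<exists>r\<ge>1. \<exists>S inc prj f.
        is_direct_sum E r (\<lambda>_. I) S inc prj \<and> f \<in> homs E X S \<and> is_inflation E f)"


section \<open>The stable category\<close>

definition proj_ideal :: "('o, 'm, 'z) exact_cat_scheme \<Rightarrow> 'o \<Rightarrow> 'o \<Rightarrow> 'm set" where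
  "proj_ideal E X Y =
     {g \<cdot>\<^bsub>E\<^esub> f | f g P. is_projective E P \<and> f \<in> homs E X P \<and> g \<in> homs E P Y}"

definition stable_class :: "('o, 'm, 'z) exact_cat_scheme \<Rightarrow> 'm \<Rightarrow> 'm set" where
  "stable_class E f =
     proj_ideal E (src E f) (tgt E f) #>\<^bsub>hom_group E (src E f) (tgt E f)\<^esub> f"

text \<open>
  The arrows of the stable category are the cosets of the groups \<open>proj_ideal E X Y\<close>. All members
  of a coset have the same source and the same target. The union defining the composite is over
  cosets that all coincide, as the composite does not depend on the representatives.
\<close>

definition stable_cat :: "('o, 'm, 'z) exact_cat_scheme \<Rightarrow> ('o, 'm set) cat" where
  "stable_cat E =
     \<lparr>obj = obj E,
      arr = (\<Union>X \<in> obj E. \<Union>Y \<in> obj E. carrier (hom_group E X Y Mod proj_ideal E X Y)),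
      src = (\<lambda>A. the_elem (src E ` A)),
      tgt = (\<lambda>A. the_elem (tgt E ` A)),
      ident = (\<lambda>X. stable_class E (ident E X)),
      cmp = (\<lambda>B A. \<Union>g \<in> B. \<Union>f \<in> A. stable_class E (g \<cdot>\<^bsub>E\<^esub> f))\<rparr>"

definition stable_retract :: "('o, 'm, 'z) exact_cat_scheme \<Rightarrow> 'o \<Rightarrow> 'o \<Rightarrow> bool" where
  "stable_retract E X Y \<longleftrightarrow> is_retract (stable_cat E) X Y"


section \<open>Delooping levels\<close>

text \<open>
  A choice of a conflation \<open>0 \<rightarrow> Om X \<rightarrow> P X \<rightarrow> X \<rightarrow> 0\<close> with \<open>P X\<close> projective for every \<open>X\<close>.
\<close>

definition is_syzygy_choice ::
    "('o, 'm, 'z) exact_cat_scheme \<Rightarrow> ('o \<Rightarrow> 'o) \<Rightarrow> ('o \<Rightarrow> 'o)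
      \<Rightarrow> ('o \<Rightarrow> 'm) \<Rightarrow> ('o \<Rightarrow> 'm) \<Rightarrow> bool" where
  "is_syzygy_choice E Om P \<iota> \<pi> \<longleftrightarrow>
     (\<forall>X \<in> obj E. is_projective E (P X) \<and>
        \<iota> X \<in> homs E (Om X) (P X) \<and> \<pi> X \<in> homs E (P X) X \<and> (\<iota> X, \<pi> X) \<in> confl E)"

text \<open>In \<open>enat\<close> the infimum of the empty set is \<open>\<infinity>\<close>.\<close>

definition k_dell ::
    "('o, 'm, 'z) exact_cat_scheme \<Rightarrow> ('o \<Rightarrow> 'o) \<Rightarrow> nat \<Rightarrow> 'o \<Rightarrow> enat" where
  "k_dell E Om k X =
     Inf {enat n | n. \<exists>Y \<in> obj E. stable_retract E ((Om ^^ n) X) ((Om ^^ (n + k)) Y)}"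

text \<open>
  The sequence \<open>0 \<rightarrow> C t \<rightarrow> \<dots> \<rightarrow> C 0 \<rightarrow> X \<rightarrow> 0\<close> has the maps \<open>d 0 : C 0 \<rightarrow> X\<close> and
  \<open>d i : C i \<rightarrow> C (i - 1)\<close> for \<open>0 < i \<le> t\<close>; it is spliced from the conflations
  \<open>0 \<rightarrow> Z (i + 1) \<rightarrow> C i \<rightarrow> Z i \<rightarrow> 0\<close> with maps \<open>a i\<close> and \<open>b i\<close>.
\<close>

definition admissibly_exact ::
    "('o, 'm, 'z) exact_cat_scheme \<Rightarrow> 'o \<Rightarrow> nat \<Rightarrow> (nat \<Rightarrow> 'o) \<Rightarrow> (nat \<Rightarrow> 'm) \<Rightarrow> bool" where
  "admissibly_exact E X t C d \<longleftrightarrow>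
     (if t = 0 then d 0 \<in> homs E (C 0) X \<and> is_iso E (d 0)
      else \<exists>Z a b. Z 0 = X \<and> Z t = C t \<and>
        (\<forall>i<t. a i \<in> homs E (Z (i + 1)) (C i) \<and> b i \<in> homs E (C i) (Z i) \<and>
           (a i, b i) \<in> confl E) \<and>
        d 0 = b 0 \<and>
        (\<forall>i. 0 < i \<and> i < t \<longrightarrow> d i = a (i - 1) \<cdot>\<^bsub>E\<^esub> b i) \<and>
        d t = a (t - 1))"

definition k_ddell ::
    "('o, 'm, 'z) exact_cat_scheme \<Rightarrow> ('o \<Rightarrow> 'o) \<Rightarrow> nat \<Rightarrow> 'o \<Rightarrow> enat" where
  "k_ddell E Om k X =
     Inf {enat m | m. \<exists>t\<le>m. \<exists>C d. admissibly_exact E X t C d \<and>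
            (\<forall>i\<le>t. k_dell E Om (i + k) (C i) \<le> enat (m - i))}"

definition ddell :: "('o, 'm, 'z) exact_cat_scheme \<Rightarrow> ('o \<Rightarrow> 'o) \<Rightarrow> 'o \<Rightarrow> enat" where
  "ddell E Om X = k_ddell E Om 1 X"

definition gddell :: "('o, 'm, 'z) exact_cat_scheme \<Rightarrow> ('o \<Rightarrow> 'o) \<Rightarrow> enat" where
  "gddell E Om = (SUP X \<in> obj E. ddell E Om X)"

definition Fddell :: "('o, 'm, 'z) exact_cat_scheme \<Rightarrow> ('o \<Rightarrow> 'o) \<Rightarrow> 'o set" where
  "Fddell E Om = {X \<in> obj E. ddell E Om X < \<infinity>}"

end

theory Submission
  imports Defs
begin

text \<open>
  If \<open>X \<rightarrow> S \<rightarrow> Y\<close> is a conflation with \<open>S\<close> a finite sum of copies of \<open>I\<close>, then the kernel \<open>L\<close> of the composite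
  of a projective cover \<open>Q \<rightarrow> S\<close> with \<open>S \<rightarrow> Y\<close> is a syzygy of \<open>Y\<close>, and Noether's isomorphism yields a
  conflation \<open>K \<rightarrow> L \<rightarrow> X\<close> with \<open>K\<close> a syzygy of \<open>S\<close>. As \<open>L\<close> is a syzygy, its delooping level is zero. A
  resolution of \<open>I\<close> witnessing its derived delooping level induces one of \<open>S\<close>, and passing to syzygies
  turns the latter into a resolution of \<open>K\<close> whose terms are one step more deloopable. Splicing it with
  \<open>K \<rightarrow> L \<rightarrow> X\<close> resolves \<open>X\<close> and costs exactly one.
\<close>

text \<open>The shift of \<open>k\<close> along a resolution is what makes the count close. If the
  terms D_i of a resolution of S satisfy (i + 1)-dell D_i \<le> m - i, then a syzygy of D_i has (i +
  2)-dell at most m - i. As term i + 1 in the resolution of X it is allowed (m + 1) - (i + 1), the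
  same number. The obstacle is that nothing is functorial on the nose: \<open>Om\<close> is an
  arbitrary choice on objects, and the kernels produced by pullbacks and products are other syzygies
  of the same objects. Everything is therefore compared up to stable retracts. A stable retract of
  an object has delooping levels no larger than that object, so a retraction in the right direction
  replaces an isomorphism. Adding up resolutions of the copies of I raises a second difficulty: a
  direct sum of n + 1 copies does not come with a direct sum of the first n. That complement is
  split off by idempotent completeness, and the resolutions are then added two at a time.\<close>

notation plus_arr (infixl "\<oplus>\<index>" 65)

lemma homs_iff: "f \<in> homs C X Y \<longleftrightarrow> f \<in> arr C \<and> src C f = X \<and> tgt C f = Y"
  by (auto simp: homs_def)

text \<open>The order of \<open>enat\<close> is discrete: if no member is at most \<open>m\<close>,
  then \<open>Suc m\<close> is a lower bound. This turns finite bounds on levels defined by infima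
  into existence statements.\<close>

lemma Inf_enat_le_iff: "Inf {enat n | n. Q n} \<le> enat m \<longleftrightarrow> (\<exists>n\<le>m. Q n)"
proof (rule iffI, rule ccontr)
  assume le: "Inf {enat n | n. Q n} \<le> enat m" and "\<not> (\<exists>n\<le>m. Q n)"
  then have "enat (Suc m) \<le> Inf {enat n | n. Q n}"
    by (intro Inf_greatest) (auto simp: not_less_eq_eq[symmetric])
  then have "enat (Suc m) \<le> enat m" using le by (rule order_trans)
  then show False by simp
next
  assume "\<exists>n\<le>m. Q n"
  then obtain n where "n \<le> m" "Q n" by blast
  then have "Inf {enat n | n. Q n} \<le> enat n" by (intro Inf_lower) auto
  then show "Inf {enat n | n. Q n} \<le> enat m" using \<open>n \<le> m\<close> by (simp add: order_trans)
qed

section \<open>Preadditive categories\<close>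

context category
begin

text \<open>The axioms mention the end points as explicit objects. With \<open>src\<close> and
  \<open>tgt\<close> in equations instead, the typing conditions of long composites can be
  discharged by rewriting.\<close>

lemma cmp_arr [simp]:
  assumes "f \<in> arr C" "g \<in> arr C" "src C g = tgt C f"
  shows "g \<cdot> f \<in> arr C" "src C (g \<cdot> f) = src C f" "tgt C (g \<cdot> f) = tgt C g"
  using cmp_homs[of f "src C f" "tgt C f" g "tgt C g"] assms by (auto simp: homs_iff)

lemma ident_arr [simp]:
  assumes "X \<in> obj C"
  shows "ident C X \<in> arr C" "src C (ident C X) = X" "tgt C (ident C X) = X"
  using ident_homs[OF assms] by (auto simp: homs_iff)

lemma cmp_ident [simp]:
  assumes "f \<in> arr C"
  shows "src C f = X \<Longrightarrow> f \<cdot> ident C X = f" "tgt C f = Y \<Longrightarrow> ident C Y \<cdot> f = f"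
  using assms cmp_ident_right[of f X "tgt C f"] cmp_ident_left[of f "src C f" Y]
  by (auto simp: homs_iff)

lemma cmp_assoc_arr [simp]:
  assumes "f \<in> arr C" "g \<in> arr C" "h \<in> arr C" "src C g = tgt C f" "src C h = tgt C g"
  shows "(h \<cdot> g) \<cdot> f = h \<cdot> (g \<cdot> f)"
  using assms by (intro cmp_assoc[of f "src C f" "tgt C f" g "tgt C g" h "tgt C h"]) (auto simp: homs_iff)

text \<open>Composites are normalised to right-nested form, where an equation for
  \<open>g \<cdot> f\<close> no longer matches once an arrow is composed on the right. This is the
  equation in the form that does.\<close>

lemma cmp_eq_extend:
  assumes "g \<cdot> f = h" "f \<in> arr C" "g \<in> arr C" "src C g = tgt C f"
    and "k \<in> arr C" "src C f = tgt C k"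
  shows "g \<cdot> (f \<cdot> k) = h \<cdot> k"
  using cmp_assoc_arr[of k f g] assms by simp

lemmas src_tgt_obj [simp] = src_obj tgt_obj

end

section \<open>Arithmetic of arrows\<close>

context preadditive_category
begin

text \<open>The group depends on the end points. Reading them off from the arrow gives an operation
  of one argument that needs no mention of a hom group.\<close>

definition neg where "neg f = m_inv (hom_group C (src C f) (tgt C f)) f"

lemma zero_arr_arr [simp]:
  assumes "X \<in> obj C" "Y \<in> obj C"
  shows "zero_arr C X Y \<in> arr C" "src C (zero_arr C X Y) = X" "tgt C (zero_arr C X Y) = Y"
proof -
  interpret comm_group "hom_group C X Y" using hom_comm_group assms .
  show "zero_arr C X Y \<in> arr C" "src C (zero_arr C X Y) = X" "tgt C (zero_arr C X Y) = Y"
    using one_closed by (auto simp: hom_group_def homs_iff)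
qed

lemma add_arr [simp]:
  assumes "f \<in> arr C" "g \<in> arr C" "src C g = src C f" "tgt C g = tgt C f"
  shows "f \<oplus> g \<in> arr C" "src C (f \<oplus> g) = src C f" "tgt C (f \<oplus> g) = tgt C f"
proof -
  interpret comm_group "hom_group C (src C f) (tgt C f)" using hom_comm_group assms by simp
  show "f \<oplus> g \<in> arr C" "src C (f \<oplus> g) = src C f" "tgt C (f \<oplus> g) = tgt C f"
    using m_closed[of f g] assms by (auto simp: hom_group_def homs_iff)
qed

lemma neg_arr [simp]:
  assumes "f \<in> arr C"
  shows "neg f \<in> arr C" "src C (neg f) = src C f" "tgt C (neg f) = tgt C f"
proof -
  interpret comm_group "hom_group C (src C f) (tgt C f)" using hom_comm_group assms by simp
  show "neg f \<in> arr C" "src C (neg f) = src C f" "tgt C (neg f) = tgt C f"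
    using inv_closed[of f] assms by (auto simp: hom_group_def homs_iff neg_def)
qed

lemma add_laws:
  assumes "f \<in> arr C" "g \<in> arr C" "src C g = src C f" "tgt C g = tgt C f"
  shows add_comm: "f \<oplus> g = g \<oplus> f"
    and add_assoc: "\<lbrakk>h \<in> arr C; src C h = src C f; tgt C h = tgt C f\<rbrakk> \<Longrightarrow> (f \<oplus> g) \<oplus> h = f \<oplus> (g \<oplus> h)"
    and add_cancel: "\<lbrakk>h \<in> arr C; src C h = src C f; tgt C h = tgt C f; f \<oplus> g = f \<oplus> h\<rbrakk> \<Longrightarrow> g = h"
proof -
  interpret comm_group "hom_group C (src C f) (tgt C f)" using hom_comm_group assms by simp
  show "f \<oplus> g = g \<oplus> f"
    using m_comm[of f g] assms by (auto simp: hom_group_def homs_iff)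
  show "(f \<oplus> g) \<oplus> h = f \<oplus> (g \<oplus> h)" if "h \<in> arr C" "src C h = src C f" "tgt C h = tgt C f"
    using m_assoc[of f g h] assms that by (auto simp: hom_group_def homs_iff)
  show "g = h" if "h \<in> arr C" "src C h = src C f" "tgt C h = tgt C f" "f \<oplus> g = f \<oplus> h"
    using Units_l_cancel[of f g h] Units_eq assms that by (auto simp: hom_group_def homs_iff)
qed

lemma add_zero [simp]:
  assumes "f \<in> arr C" "src C f = X" "tgt C f = Y"
  shows "f \<oplus> zero_arr C X Y = f" "zero_arr C X Y \<oplus> f = f"
    "f \<oplus> neg f = zero_arr C X Y" "neg f \<oplus> f = zero_arr C X Y"
proof -
  interpret comm_group "hom_group C X Y" using hom_comm_group assms by auto
  show "f \<oplus> zero_arr C X Y = f" "zero_arr C X Y \<oplus> f = f"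
    "f \<oplus> neg f = zero_arr C X Y" "neg f \<oplus> f = zero_arr C X Y"
    using r_one[of f] l_one[of f] r_inv[of f] l_inv[of f] assms
    by (auto simp: hom_group_def homs_iff neg_def)
qed

lemma add_left_comm:
  assumes "f \<in> arr C" "g \<in> arr C" "h \<in> arr C"
    and "src C g = src C f" "tgt C g = tgt C f" "src C h = src C f" "tgt C h = tgt C f"
  shows "f \<oplus> (g \<oplus> h) = g \<oplus> (f \<oplus> h)"
  using assms add_assoc[of f g h] add_assoc[of g f h] add_comm[of f g] by simp

lemma cmp_add:
  assumes "f \<in> arr C" "f' \<in> arr C" "src C f' = src C f" "tgt C f' = tgt C f" "g \<in> arr C"
  shows "src C g = tgt C f \<Longrightarrow> g \<cdot> (f \<oplus> f') = g \<cdot> f \<oplus> g \<cdot> f'"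
    and "src C f = tgt C g \<Longrightarrow> (f \<oplus> f') \<cdot> g = f \<cdot> g \<oplus> f' \<cdot> g"
  using assms
  by (auto intro!: cmp_plus_right[of f "src C f" "tgt C f" f' g "tgt C g"]
      cmp_plus_left[of g "src C g" "tgt C g" f "tgt C f" f'] simp: homs_iff)

text \<open>The zero arrow is its own double, so by distributivity the composite is its own double
  as well, and cancellation makes it zero.\<close>

lemma cmp_zero [simp]:
  assumes "f \<in> arr C" "X \<in> obj C"
  shows "src C f = Y \<Longrightarrow> f \<cdot> zero_arr C X Y = zero_arr C X (tgt C f)"
    and "tgt C f = Y \<Longrightarrow> zero_arr C Y X \<cdot> f = zero_arr C (src C f) X"
proof -
  show "f \<cdot> zero_arr C X Y = zero_arr C X (tgt C f)" if Y: "src C f = Y"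
  proof -
    have Yo: "Y \<in> obj C" using assms Y by auto
    have "f \<cdot> zero_arr C X Y \<oplus> f \<cdot> zero_arr C X Y = f \<cdot> zero_arr C X Y \<oplus> zero_arr C X (tgt C f)"
      using cmp_add(1)[of "zero_arr C X Y" "zero_arr C X Y" f] assms Y Yo by simp
    then show ?thesis
      using add_cancel[of "f \<cdot> zero_arr C X Y" "f \<cdot> zero_arr C X Y" "zero_arr C X (tgt C f)"] assms Y Yo by simp
  qed
  show "zero_arr C Y X \<cdot> f = zero_arr C (src C f) X" if Y: "tgt C f = Y"
  proof -
    have Yo: "Y \<in> obj C" using assms Y by auto
    have "zero_arr C Y X \<cdot> f \<oplus> zero_arr C Y X \<cdot> f = zero_arr C Y X \<cdot> f \<oplus> zero_arr C (src C f) X"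
      using cmp_add(2)[of "zero_arr C Y X" "zero_arr C Y X" f] assms Y Yo by simp
    then show ?thesis
      using add_cancel[of "zero_arr C Y X \<cdot> f" "zero_arr C Y X \<cdot> f" "zero_arr C (src C f) X"] assms Y Yo by simp
  qed
qed

text \<open>The bracketing that occurs when a difference of two arrows has been factored through a
  kernel and is added back.\<close>

lemma add_add_neg:
  assumes "f \<in> arr C" "g \<in> arr C" "src C g = src C f" "tgt C g = tgt C f"
  shows "g \<oplus> (f \<oplus> neg g) = f"
  using assms add_left_comm[of g f "neg g"] by simp

lemma cmp_neg:
  assumes "f \<in> arr C" "g \<in> arr C" "src C g = tgt C f"
  shows "g \<cdot> neg f = neg (g \<cdot> f)" "neg g \<cdot> f = neg (g \<cdot> f)"
proof -
  have "g \<cdot> f \<oplus> g \<cdot> neg f = g \<cdot> f \<oplus> neg (g \<cdot> f)"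
    using cmp_add(1)[of f "neg f" g] assms by simp
  then show "g \<cdot> neg f = neg (g \<cdot> f)"
    using add_cancel[of "g \<cdot> f" "g \<cdot> neg f" "neg (g \<cdot> f)"] assms by simp
  have "g \<cdot> f \<oplus> neg g \<cdot> f = g \<cdot> f \<oplus> neg (g \<cdot> f)"
    using cmp_add(2)[of g "neg g" f] assms by simp
  then show "neg g \<cdot> f = neg (g \<cdot> f)"
    using add_cancel[of "g \<cdot> f" "neg g \<cdot> f" "neg (g \<cdot> f)"] assms by simp
qed

section \<open>Kernels and pullbacks\<close>

lemma kernelD:
  assumes "is_kernel C i p"
  shows "i \<in> arr C" "p \<in> arr C" "tgt C i = src C p" "p \<cdot> i = zero_arr C (src C i) (tgt C p)"
  using assms by (auto simp: is_kernel_def)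

lemma kernel_factor:
  assumes "is_kernel C i p" "f \<in> arr C" "tgt C f = src C p" "p \<cdot> f = zero_arr C (src C f) (tgt C p)"
  obtains g where "g \<in> arr C" "src C g = src C f" "tgt C g = src C i" "i \<cdot> g = f"
proof -
  have "\<exists>!g. g \<in> homs C (src C f) (src C i) \<and> i \<cdot> g = f"
    using assms src_obj[of f] unfolding is_kernel_def by (auto simp: homs_iff)
  then show ?thesis using that by (auto simp: homs_iff)
qed

lemma kernel_mono:
  assumes k: "is_kernel C i p" and g: "g \<in> arr C" "g' \<in> arr C" "tgt C g = src C i" "tgt C g' = src C i"
    "src C g = src C g'" "i \<cdot> g = i \<cdot> g'"
  shows "g = g'"
proof -
  note kd = kernelD[OF k]
  have "p \<cdot> (i \<cdot> g) = zero_arr C (src C g) (tgt C p)"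
    using cmp_eq_extend[OF kd(4), of g] kd g by simp
  then have "\<exists>!h. h \<in> homs C (src C g) (src C i) \<and> i \<cdot> h = i \<cdot> g"
    using k g kd unfolding is_kernel_def by (auto simp: homs_iff)
  then show ?thesis using g by (auto simp: homs_iff)
qed

lemma pullbackD:
  assumes "is_pullback C p f p' f'"
  shows "p \<in> arr C" "f \<in> arr C" "p' \<in> arr C" "f' \<in> arr C" "tgt C f = tgt C p" "tgt C p' = src C f"
    "src C f' = src C p'" "tgt C f' = src C p" "p \<cdot> f' = f \<cdot> p'"
  using assms by (auto simp: is_pullback_def homs_iff)

lemma pullback_factor:
  assumes "is_pullback C p f p' f'" "a \<in> arr C" "b \<in> arr C" "src C b = src C a"
    "tgt C a = src C p" "tgt C b = src C f" "p \<cdot> a = f \<cdot> b"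
  obtains h where "h \<in> arr C" "src C h = src C a" "tgt C h = src C p'" "f' \<cdot> h = a" "p' \<cdot> h = b"
proof -
  have "\<exists>!h. h \<in> homs C (src C a) (src C p') \<and> f' \<cdot> h = a \<and> p' \<cdot> h = b"
    using assms src_obj[of a] unfolding is_pullback_def by (auto simp: homs_iff)
  then show ?thesis using that by (auto simp: homs_iff)
qed

lemma pullback_unique:
  assumes pb: "is_pullback C p f p' f'" and h: "h \<in> arr C" "h' \<in> arr C" "src C h' = src C h"
    "tgt C h = src C p'" "tgt C h' = src C p'" "f' \<cdot> h = f' \<cdot> h'" "p' \<cdot> h = p' \<cdot> h'"
  shows "h = h'"
proof -
  note pd = pullbackD[OF pb]
  have "p \<cdot> (f' \<cdot> h) = f \<cdot> (p' \<cdot> h)"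
    using cmp_eq_extend[OF pd(9), of h] pd h by simp
  then have "\<exists>!k. k \<in> homs C (src C h) (src C p') \<and> f' \<cdot> k = f' \<cdot> h \<and> p' \<cdot> k = p' \<cdot> h"
    using pb h pd unfolding is_pullback_def by (auto simp: homs_iff)
  then show ?thesis using h by (auto simp: homs_iff)
qed

section \<open>Binary products and biproducts\<close>

definition is_product where
  "is_product Q f g \<longleftrightarrow> f \<in> arr C \<and> g \<in> arr C \<and> src C f = Q \<and> src C g = Q \<and>
    (\<forall>a \<in> arr C. \<forall>b \<in> arr C. src C a = src C b \<longrightarrow> tgt C a = tgt C f \<longrightarrow> tgt C b = tgt C g \<longrightarrow>
      (\<exists>!h. h \<in> homs C (src C a) Q \<and> f \<cdot> h = a \<and> g \<cdot> h = b))"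

lemma productD:
  assumes "is_product Q f g"
  shows "f \<in> arr C" "g \<in> arr C" "src C f = Q" "src C g = Q"
  using assms by (auto simp: is_product_def)

lemma product_factor:
  assumes "is_product Q f g" "a \<in> arr C" "b \<in> arr C" "src C b = src C a" "tgt C a = tgt C f" "tgt C b = tgt C g"
  obtains h where "h \<in> arr C" "src C h = src C a" "tgt C h = Q" "f \<cdot> h = a" "g \<cdot> h = b"
proof -
  have "\<exists>!h. h \<in> homs C (src C a) Q \<and> f \<cdot> h = a \<and> g \<cdot> h = b"
    using assms(1-3,5,6) assms(4)[symmetric] unfolding is_product_def by simp
  then show ?thesis using that by (auto simp: homs_iff)
qed

lemma product_unique:
  assumes pr: "is_product Q f g" and h: "h \<in> arr C" "h' \<in> arr C" "src C h' = src C h"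
    "tgt C h = Q" "tgt C h' = Q" "f \<cdot> h = f \<cdot> h'" "g \<cdot> h = g \<cdot> h'"
  shows "h = h'"
proof -
  note pd = productD[OF pr]
  have "\<exists>!k. k \<in> homs C (src C h) Q \<and> f \<cdot> k = f \<cdot> h \<and> g \<cdot> k = g \<cdot> h"
    using pr h pd unfolding is_product_def by (elim conjE) (drule bspec[of _ _ "f \<cdot> h"], simp, drule bspec[of _ _ "g \<cdot> h"], simp, simp)
  then show ?thesis using h by (auto simp: homs_iff)
qed

lemma productI:
  assumes "f \<in> arr C" "g \<in> arr C" "src C f = Q" "src C g = Q"
    and ex: "\<And>a b. \<lbrakk>a \<in> arr C; b \<in> arr C; src C b = src C a; tgt C a = tgt C f; tgt C b = tgt C g\<rbrakk>
      \<Longrightarrow> \<exists>h. h \<in> arr C \<and> src C h = src C a \<and> tgt C h = Q \<and> f \<cdot> h = a \<and> g \<cdot> h = b"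
    and un: "\<And>h h'. \<lbrakk>h \<in> arr C; h' \<in> arr C; src C h' = src C h; tgt C h = Q; tgt C h' = Q;
        f \<cdot> h = f \<cdot> h'; g \<cdot> h = g \<cdot> h'\<rbrakk> \<Longrightarrow> h = h'"
  shows "is_product Q f g"
  unfolding is_product_def
proof (intro conjI ballI impI assms(1-4))
  fix a b assume ab: "a \<in> arr C" "b \<in> arr C" "src C a = src C b" "tgt C a = tgt C f" "tgt C b = tgt C g"
  obtain h where h: "h \<in> arr C" "src C h = src C a" "tgt C h = Q" "f \<cdot> h = a" "g \<cdot> h = b"
    using ex[of a b] ab by auto
  show "\<exists>!h. h \<in> homs C (src C a) Q \<and> f \<cdot> h = a \<and> g \<cdot> h = b"
    using h by (auto simp: homs_iff intro!: ex1I[of _ h] un)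
qed

definition is_biproduct where
  "is_biproduct S i p j q \<longleftrightarrow> i \<in> arr C \<and> p \<in> arr C \<and> j \<in> arr C \<and> q \<in> arr C \<and>
    tgt C i = S \<and> src C p = S \<and> tgt C j = S \<and> src C q = S \<and> src C i = tgt C p \<and> src C j = tgt C q \<and>
    p \<cdot> i = ident C (tgt C p) \<and> q \<cdot> j = ident C (tgt C q) \<and>
    p \<cdot> j = zero_arr C (tgt C q) (tgt C p) \<and> q \<cdot> i = zero_arr C (tgt C p) (tgt C q) \<and>
    i \<cdot> p \<oplus> j \<cdot> q = ident C S"

lemma biproduct_product:
  assumes "is_biproduct S i p j q"
  shows "is_product S p q"
proof (rule productI)
  note b = assms[unfolded is_biproduct_def]
  show "p \<in> arr C" "q \<in> arr C" "src C p = S" "src C q = S" using b by auto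
  show "\<exists>h. h \<in> arr C \<and> src C h = src C a \<and> tgt C h = S \<and> p \<cdot> h = a \<and> q \<cdot> h = c"
    if ac: "a \<in> arr C" "c \<in> arr C" "src C c = src C a" "tgt C a = tgt C p" "tgt C c = tgt C q" for a c
  proof (intro exI conjI)
    have pi: "p \<cdot> (i \<cdot> a) = a" "p \<cdot> (j \<cdot> c) = zero_arr C (src C c) (tgt C p)"
      "q \<cdot> (j \<cdot> c) = c" "q \<cdot> (i \<cdot> a) = zero_arr C (src C a) (tgt C q)"
      using b ac cmp_eq_extend[of p i "ident C (tgt C p)" a] cmp_eq_extend[of p j "zero_arr C (tgt C q) (tgt C p)" c]
        cmp_eq_extend[of q j "ident C (tgt C q)" c] cmp_eq_extend[of q i "zero_arr C (tgt C p) (tgt C q)" a]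
      by auto
    let ?h = "i \<cdot> a \<oplus> j \<cdot> c"
    show "?h \<in> arr C" "src C ?h = src C a" "tgt C ?h = S" using b ac by auto
    show "p \<cdot> ?h = a" "q \<cdot> ?h = c"
      using b ac pi by (auto simp: cmp_add)
  qed
  show "h = h'"
    if h: "h \<in> arr C" "h' \<in> arr C" "src C h' = src C h" "tgt C h = S" "tgt C h' = S"
      "p \<cdot> h = p \<cdot> h'" "q \<cdot> h = q \<cdot> h'" for h h'
  proof -
    \<comment> \<open>Every arrow into \<open>S\<close> is recovered from its two
      components.\<close>
    have *: "x = i \<cdot> (p \<cdot> x) \<oplus> j \<cdot> (q \<cdot> x)" if "x \<in> arr C" "tgt C x = S" for x
    proof -
      have "x = (i \<cdot> p \<oplus> j \<cdot> q) \<cdot> x" using b that by auto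
      also have "\<dots> = i \<cdot> (p \<cdot> x) \<oplus> j \<cdot> (q \<cdot> x)"
        using conjunct1[OF b] b that by (subst cmp_add(2)) auto
      finally show ?thesis .
    qed
    show ?thesis using *[of h] *[of h'] h by simp
  qed
qed

text \<open>The injections have components \<open>(1, 0)\<close> and \<open>(0, 1)\<close>, and the
  last biproduct equation holds because both sides have the same components. Constructions below
  carry only projections, since universal properties pass through pullbacks and kernels; injections
  are recovered here when maps have to be added.\<close>

lemma product_biproduct:
  assumes pr: "is_product S p q"
  obtains i j where "is_biproduct S i p j q"
proof -
  note pd = productD[OF pr]
  have So: "S \<in> obj C" using pd by auto
  obtain i where i: "i \<in> arr C" "src C i = tgt C p" "tgt C i = S" "p \<cdot> i = ident C (tgt C p)"
    "q \<cdot> i = zero_arr C (tgt C p) (tgt C q)"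
    by (rule product_factor[OF pr, of "ident C (tgt C p)" "zero_arr C (tgt C p) (tgt C q)"]) (use pd in auto)
  obtain j where j: "j \<in> arr C" "src C j = tgt C q" "tgt C j = S" "p \<cdot> j = zero_arr C (tgt C q) (tgt C p)"
    "q \<cdot> j = ident C (tgt C q)"
    by (rule product_factor[OF pr, of "zero_arr C (tgt C q) (tgt C p)" "ident C (tgt C q)"]) (use pd in auto)
  have e: "p \<cdot> (i \<cdot> p) = p" "p \<cdot> (j \<cdot> q) = zero_arr C S (tgt C p)"
    "q \<cdot> (j \<cdot> q) = q" "q \<cdot> (i \<cdot> p) = zero_arr C S (tgt C q)"
    using pd i j cmp_eq_extend[OF i(4), of p] cmp_eq_extend[OF j(4), of q]
      cmp_eq_extend[OF j(5), of q] cmp_eq_extend[OF i(5), of p]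
    by auto
  have "i \<cdot> p \<oplus> j \<cdot> q = ident C S"
    by (rule product_unique[OF pr]) (use pd i j e So in \<open>auto simp: cmp_add\<close>)
  then have "is_biproduct S i p j q"
    using pd i j unfolding is_biproduct_def by auto
  then show ?thesis by (rule that)
qed

section \<open>Finite sums of arrows and finite direct sums\<close>

lemma finprod_hom:
  assumes XY: "X \<in> obj C" "Y \<in> obj C"
    and f: "\<And>j. j < n \<Longrightarrow> f j \<in> homs C X Y"
  shows "finprod (hom_group C X Y) f {..<n} \<in> homs C X Y"
proof -
  interpret comm_group "hom_group C X Y" using hom_comm_group XY .
  show ?thesis using finprod_closed[of f "{..<n}"] f by (auto simp: hom_group_def)
qed

lemma finprod_hom_Suc:
  assumes XY: "X \<in> obj C" "Y \<in> obj C"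
    and f: "\<And>j. j < Suc n \<Longrightarrow> f j \<in> homs C X Y"
  shows "finprod (hom_group C X Y) f {..<Suc n} = f n \<oplus> finprod (hom_group C X Y) f {..<n}"
proof -
  interpret comm_group "hom_group C X Y" using hom_comm_group XY .
  have "finprod (hom_group C X Y) f (insert n {..<n})
      = f n \<otimes>\<^bsub>hom_group C X Y\<^esub> finprod (hom_group C X Y) f {..<n}"
    by (rule finprod_insert) (use f in \<open>auto simp: hom_group_def\<close>)
  then show ?thesis by (simp add: lessThan_Suc hom_group_def)
qed

lemma finprod_hom_0:
  assumes "X \<in> obj C" "Y \<in> obj C"
  shows "finprod (hom_group C X Y) f {..<0::nat} = zero_arr C X Y"
proof -
  interpret comm_group "hom_group C X Y" using hom_comm_group assms .
  show ?thesis using finprod_empty[of f] by (simp add: hom_group_def)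
qed

text \<open>Bilinearity on both sides at once, in the form that transports a sum of the idempotents
  \<open>inc j \<cdot> prj j\<close> along a splitting.\<close>

lemma cmp_finprod_cmp:
  fixes n :: nat
  assumes "r \<in> homs C Y Y'" "s \<in> homs C X' X"
    and f: "\<And>j. j < n \<Longrightarrow> f j \<in> homs C X Y"
  shows "r \<cdot> finprod (hom_group C X Y) f {..<n} \<cdot> s = finprod (hom_group C X' Y') (\<lambda>j. r \<cdot> f j \<cdot> s) {..<n}"
proof -
  have rs: "r \<in> arr C" "src C r = Y" "tgt C r = Y'" "s \<in> arr C" "src C s = X'" "tgt C s = X"
    and o: "X \<in> obj C" "Y \<in> obj C" "X' \<in> obj C" "Y' \<in> obj C"
    using assms(1,2) src_obj tgt_obj by (auto simp: homs_iff)
  show ?thesis using f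
  proof (induction n)
    case 0
    show ?case unfolding finprod_hom_0[OF o(1,2)] finprod_hom_0[OF o(3,4)] using rs o by simp
  next
    case (Suc n)
    have f: "f j \<in> arr C" "src C (f j) = X" "tgt C (f j) = Y" if "j < Suc n" for j
      using Suc.prems[OF that] by (auto simp: homs_iff)
    have F: "finprod (hom_group C X Y) f {..<n} \<in> arr C" "src C (finprod (hom_group C X Y) f {..<n}) = X"
      "tgt C (finprod (hom_group C X Y) f {..<n}) = Y"
      using finprod_hom[OF o(1,2), of n f] Suc.prems by (auto simp: homs_iff)
    have "finprod (hom_group C X' Y') (\<lambda>j. r \<cdot> f j \<cdot> s) {..<Suc n}
        = r \<cdot> f n \<cdot> s \<oplus> finprod (hom_group C X' Y') (\<lambda>j. r \<cdot> f j \<cdot> s) {..<n}"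
      by (rule finprod_hom_Suc[OF o(3,4)]) (use f rs in \<open>auto simp: homs_iff\<close>)
    also have "\<dots> = r \<cdot> f n \<cdot> s \<oplus> r \<cdot> finprod (hom_group C X Y) f {..<n} \<cdot> s"
      using Suc.IH Suc.prems by simp
    also have "\<dots> = r \<cdot> (f n \<oplus> finprod (hom_group C X Y) f {..<n}) \<cdot> s"
      using f[of n] F rs by (simp add: cmp_add)
    also have "f n \<oplus> finprod (hom_group C X Y) f {..<n} = finprod (hom_group C X Y) f {..<Suc n}"
      by (rule finprod_hom_Suc[OF o(1,2), symmetric]) (use Suc.prems in auto)
    finally show ?case by simp
  qed
qed

text \<open>The complement of the last summand is not part of the data of a direct sum. It is
  obtained by splitting \<open>e\<close>, the sum of the first \<open>n\<close> idempotents, which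
  equals \<open>1 - inc n \<cdot> prj n\<close>. This is where idempotent completeness
  enters.\<close>

lemma direct_sum_Suc:
  assumes ic: "idempotent_complete C" and ds: "is_direct_sum C (Suc n) X S inc prj"
  obtains S' inc' prj' s r where "is_direct_sum C n X S' inc' prj'" "is_biproduct S s r (inc n) (prj n)"
    "tgt C r = S'" "tgt C (prj n) = X n"
proof -
  define e where "e = finprod (hom_group C S S) (\<lambda>j. inc j \<cdot> prj j) {..<n}"
  have S: "S \<in> obj C" using ds by (simp add: is_direct_sum_def)
  have ip: "inc j \<in> arr C" "src C (inc j) = X j" "tgt C (inc j) = S"
      "prj j \<in> arr C" "src C (prj j) = S" "tgt C (prj j) = X j" if "j < Suc n" for j
    using ds that by (auto simp: is_direct_sum_def homs_iff)
  have pi: "prj j \<cdot> inc k = (if j = k then ident C (X j) else zero_arr C (X k) (X j))"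
    if "j < Suc n" "k < Suc n" for j k
    using ds that by (simp add: is_direct_sum_def)
  have X: "X j \<in> obj C" if "j < Suc n" for j using ip[OF that] src_obj[of "inc j"] by simp
  have e_hom: "e \<in> homs C S S"
    unfolding e_def by (rule finprod_hom[OF S S]) (use ip in \<open>auto simp: homs_iff\<close>)
  then have e: "e \<in> arr C" "src C e = S" "tgt C e = S" by (auto simp: homs_iff)
  note n = ip[OF lessI]
  have one: "inc n \<cdot> prj n \<oplus> e = ident C S"
    unfolding e_def by (subst finprod_hom_Suc[OF S S, symmetric])
      (use ds ip in \<open>auto simp: is_direct_sum_def homs_iff\<close>)
  have pin: "prj n \<cdot> inc n = ident C (X n)" using pi[of n n] by simp
  have Xn: "X n \<in> obj C" using X by simp
  \<comment> \<open>The relations between \<open>e\<close> and the last summand follow from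
    \<open>inc n \<cdot> prj n \<oplus> e = 1\<close> by cancellation, without expanding the sum
    \<open>e\<close>.\<close>
  have "inc n \<oplus> e \<cdot> inc n = (inc n \<cdot> prj n \<oplus> e) \<cdot> inc n"
    using n e pin by (simp add: cmp_add)
  then have "inc n \<oplus> e \<cdot> inc n = inc n \<oplus> zero_arr C (X n) S"
    using n one by simp
  then have en: "e \<cdot> inc n = zero_arr C (X n) S"
    using add_cancel[of "inc n" "e \<cdot> inc n" "zero_arr C (X n) S"] n e Xn S by simp
  have pinp: "prj n \<cdot> inc n \<cdot> prj n = prj n"
    using cmp_eq_extend[OF pin, of "prj n"] n by simp
  have "prj n \<oplus> prj n \<cdot> e = prj n \<cdot> (inc n \<cdot> prj n \<oplus> e)"
    using n e pinp by (simp add: cmp_add)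
  then have "prj n \<oplus> prj n \<cdot> e = prj n \<oplus> zero_arr C S (X n)"
    using n one by simp
  then have pe: "prj n \<cdot> e = zero_arr C S (X n)"
    using add_cancel[of "prj n" "prj n \<cdot> e" "zero_arr C S (X n)"] n e Xn S by simp
  have enp: "e \<cdot> inc n \<cdot> prj n = zero_arr C S S"
    using cmp_eq_extend[OF en, of "prj n"] n e S by simp
  have "e = e \<cdot> (inc n \<cdot> prj n \<oplus> e)" using e one by simp
  also have "\<dots> = e \<cdot> e" using cmp_add(1)[of "inc n \<cdot> prj n" e e] n e enp by simp
  finally have ee: "e \<cdot> e = e" by simp
  obtain S' r s where S': "S' \<in> obj C" "r \<in> homs C S S'" "s \<in> homs C S' S" and sr: "s \<cdot> r = e"
    and rs: "r \<cdot> s = ident C S'"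
    using ic S e_hom ee unfolding idempotent_complete_def by blast
  then have r: "r \<in> arr C" "src C r = S" "tgt C r = S'" and s: "s \<in> arr C" "src C s = S'" "tgt C s = S"
    by (auto simp: homs_iff)
  have re: "r \<cdot> e = r" using cmp_eq_extend[OF rs, of r] r s sr by simp
  have es: "e \<cdot> s = s" using cmp_eq_extend[OF sr, of s] r s rs by simp
  have rn: "r \<cdot> inc n = zero_arr C (X n) S'"
    using cmp_eq_extend[OF re, of "inc n"] en n r e S' Xn by simp
  have ns: "prj n \<cdot> s = zero_arr C S' (X n)"
    using cmp_eq_extend[OF pe, of s] es n s e S' Xn by simp
  have "is_biproduct S s r (inc n) (prj n)"
    unfolding is_biproduct_def
    using r s n rs pin rn ns one sr add_comm[of "inc n \<cdot> prj n" e] e by simp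
  moreover have "is_direct_sum C n X S' (\<lambda>j. r \<cdot> inc j) (\<lambda>j. prj j \<cdot> s)"
    unfolding is_direct_sum_def
  proof (intro conjI allI impI S')
    show "r \<cdot> inc j \<in> homs C (X j) S'" "prj j \<cdot> s \<in> homs C S' (X j)" if "j < n" for j
      using that r s ip[of j] by (auto simp: homs_iff)
    show "(prj j \<cdot> s) \<cdot> r \<cdot> inc k = (if j = k then ident C (X j) else zero_arr C (X k) (X j))"
      if "j < n" "k < n" for j k
    proof -
      have jk: "j < Suc n" "k < Suc n" using that by auto
      note j = ip[OF jk(1)] and k = ip[OF jk(2)]
      \<comment> \<open>By orthogonality \<open>e\<close> fixes \<open>inc k\<close>. Hence passing
        to \<open>S'\<close> and back, which is \<open>s \<cdot> r = e\<close>, does not change the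
        composites \<open>prj j \<cdot> inc k\<close>.\<close>
      have 0: "prj n \<cdot> inc k = zero_arr C (X k) (X n)" using pi[OF lessI jk(2)] that by simp
      have "inc k = (inc n \<cdot> prj n \<oplus> e) \<cdot> inc k" using one k by simp
      also have "\<dots> = e \<cdot> inc k"
        using cmp_add(2)[of "inc n \<cdot> prj n" e "inc k"] n e k 0 X[OF jk(2)] S by simp
      finally have "e \<cdot> inc k = inc k" by simp
      then have "s \<cdot> r \<cdot> inc k = inc k" using cmp_eq_extend[OF sr, of "inc k"] s r k by simp
      then show ?thesis using pi[OF jk] j k r s by simp
    qed
    \<comment> \<open>The sum of the transported idempotents is
      \<open>r \<cdot> e \<cdot> s\<close>, which the splitting equations reduce to the identity of
      \<open>S'\<close>.\<close>
    have "r \<cdot> e \<cdot> s = finprod (hom_group C S' S') (\<lambda>j. r \<cdot> (inc j \<cdot> prj j) \<cdot> s) {..<n}"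
      unfolding e_def by (rule cmp_finprod_cmp[OF S'(2,3)]) (use ip in \<open>auto simp: homs_iff\<close>)
    moreover interpret comm_group "hom_group C S' S'" by (rule hom_comm_group[OF S'(1,1)])
    have "finprod (hom_group C S' S') (\<lambda>j. (r \<cdot> inc j) \<cdot> prj j \<cdot> s) {..<n}
       = finprod (hom_group C S' S') (\<lambda>j. r \<cdot> (inc j \<cdot> prj j) \<cdot> s) {..<n}"
      by (rule finprod_cong') (use ip r s in \<open>auto simp: hom_group_def homs_iff\<close>)
    ultimately show "finprod (hom_group C S' S') (\<lambda>j. (r \<cdot> inc j) \<cdot> prj j \<cdot> s) {..<n} = ident C S'"
      using es rs by simp
  qed
  ultimately show ?thesis using that r n by blast
qed

end

lemma (in additive_category) biproduct_exists:
  assumes "X \<in> obj C" "Y \<in> obj C"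
  obtains S i p j q where "is_biproduct S i p j q" "tgt C p = X" "tgt C q = Y"
proof -
  obtain S inc prj where ds: "is_direct_sum C 2 (\<lambda>j. if j = 0 then X else Y) S inc prj"
  proof -
    have "\<exists>S inc prj. is_direct_sum C 2 (\<lambda>j. if j = 0 then X else Y) S inc prj"
      by (rule direct_sums_exist) (use assms in auto)
    then show ?thesis using that by blast
  qed
  have S: "S \<in> obj C" using ds by (simp add: is_direct_sum_def)
  have ip: "inc j \<in> arr C" "src C (inc j) = (if j = 0 then X else Y)" "tgt C (inc j) = S"
      "prj j \<in> arr C" "src C (prj j) = S" "tgt C (prj j) = (if j = 0 then X else Y)" if "j < 2" for j
    using ds that by (auto simp: is_direct_sum_def homs_iff)
  have "inc 1 \<cdot> prj 1 \<oplus> (inc 0 \<cdot> prj 0 \<oplus> zero_arr C S S)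
      = finprod (hom_group C S S) (\<lambda>j. inc j \<cdot> prj j) {..<Suc (Suc 0)}"
    using ip by (subst finprod_hom_Suc[OF S S] finprod_hom_0[OF S S], simp add: homs_iff)+
  also have "\<dots> = ident C S" using ds by (simp add: is_direct_sum_def numeral_2_eq_2)
  finally have "inc 0 \<cdot> prj 0 \<oplus> inc 1 \<cdot> prj 1 = ident C S"
    using ip[of 0] ip[of 1] S add_comm[of "inc 0 \<cdot> prj 0" "inc 1 \<cdot> prj 1"] by simp
  moreover have "prj j \<cdot> inc k = (if j = k then ident C (if j = 0 then X else Y)
      else zero_arr C (if k = 0 then X else Y) (if j = 0 then X else Y))" if "j < 2" "k < 2" for j k
    using ds that by (simp add: is_direct_sum_def)
  from this[of 0 0] this[of 0 1] this[of 1 0] this[of 1 1]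
  have "prj 0 \<cdot> inc 0 = ident C X" "prj 0 \<cdot> inc 1 = zero_arr C Y X" "prj 1 \<cdot> inc 0 = zero_arr C X Y"
    "prj 1 \<cdot> inc 1 = ident C Y" by simp_all
  ultimately have "is_biproduct S (inc 0) (prj 0) (inc 1) (prj 1)"
    using ip[of 0] ip[of 1] by (simp add: is_biproduct_def)
  then show ?thesis using that ip[of 0] ip[of 1] by simp
qed

section \<open>Conflations\<close>

context exact_category
begin

lemma conflD:
  assumes "(i, p) \<in> confl E"
  shows "i \<in> arr E" "p \<in> arr E" "tgt E i = src E p" "p \<cdot> i = zero_arr E (src E i) (tgt E p)"
  using kernelD[OF confl_kernel[OF assms]] by auto

lemma deflationD:
  assumes "is_deflation E p" shows "p \<in> arr E"
  using assms conflD(2) by (auto simp: is_deflation_def)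

text \<open>The axioms on deflations provide only some unspecified inflation. Two kernels of
  \<open>p\<close> are isomorphic over its source, so closure under isomorphism allows that
  inflation to be replaced by any kernel described explicitly.\<close>

lemma confl_of_kernel:
  assumes c: "(i0, p) \<in> confl E" and k: "is_kernel E i p"
  shows "(i, p) \<in> confl E"
proof -
  note k0 = confl_kernel[OF c]
  note d0 = kernelD[OF k0] and d = kernelD[OF k]
  obtain a where a: "a \<in> arr E" "src E a = src E i" "tgt E a = src E i0" "i0 \<cdot> a = i"
    by (rule kernel_factor[OF k0, of i]) (use d in auto)
  obtain a' where a': "a' \<in> arr E" "src E a' = src E i0" "tgt E a' = src E i" "i \<cdot> a' = i0"
    by (rule kernel_factor[OF k, of i0]) (use d0 in auto)
  have "i0 \<cdot> (a \<cdot> a') = i0" "i \<cdot> (a' \<cdot> a) = i"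
    using cmp_eq_extend[OF a(4), of a'] cmp_eq_extend[OF a'(4), of a] a a' d d0 by auto
  then have inv: "a \<cdot> a' = ident E (src E i0)" "a' \<cdot> a = ident E (src E i)"
    using kernel_mono[OF k0, of "a \<cdot> a'" "ident E (src E i0)"] kernel_mono[OF k, of "a' \<cdot> a" "ident E (src E i)"]
      a a' d d0 by auto
  have "is_cokernel E p i"
    unfolding is_cokernel_def
  proof (intro conjI ballI impI)
    show "i \<in> arr E" "p \<in> arr E" "tgt E i = src E p" "p \<cdot> i = zero_arr E (src E i) (tgt E p)"
      using d by auto
    fix T f assume T: "T \<in> obj E" "f \<in> homs E (tgt E i) T" "f \<cdot> i = zero_arr E (src E i) T"
    have "f \<cdot> i0 = zero_arr E (src E i0) T"
      using cmp_eq_extend[OF T(3), of a'] T a' d by (auto simp: homs_iff)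
    then show "\<exists>!g. g \<in> homs E (tgt E p) T \<and> g \<cdot> p = f"
      using confl_cokernel[OF c] T d d0 unfolding is_cokernel_def by auto
  qed
  moreover have "is_iso E a'"
    using a a' inv unfolding is_iso_def by (auto simp: homs_iff intro!: bexI[of _ a])
  moreover have "is_iso E (ident E X)" if "X \<in> obj E" for X
    using that unfolding is_iso_def by (auto simp: homs_iff intro!: bexI[of _ "ident E X"])
  ultimately show ?thesis
    using confl_iso_closed[OF c k, of a' "ident E (src E p)" "ident E (tgt E p)"] a' d d0
    by (auto simp: homs_iff)
qed

text \<open>The new inflation is the arrow into the pullback with components \<open>i\<close> and
  zero. The kernel object is therefore unchanged.\<close>

lemma confl_pullback:
  assumes c: "(i, p) \<in> confl E" and f: "f \<in> arr E" "tgt E f = tgt E p"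
  obtains i' p' f' where "(i', p') \<in> confl E" "is_pullback E p f p' f'" "src E i' = src E i" "f' \<cdot> i' = i"
proof -
  note k = confl_kernel[OF c] and cd = conflD[OF c]
  obtain p' f' where pb: "is_pullback E p f p' f'" and "is_deflation E p'"
    using deflation_pullback[of p f] c f by (auto simp: is_deflation_def)
  then obtain i0 where c0: "(i0, p') \<in> confl E" by (auto simp: is_deflation_def)
  note pd = pullbackD[OF pb]
  obtain i' where i': "i' \<in> arr E" "src E i' = src E i" "tgt E i' = src E p'" "f' \<cdot> i' = i"
    "p' \<cdot> i' = zero_arr E (src E i) (src E f)"
    by (rule pullback_factor[OF pb, of i "zero_arr E (src E i) (src E f)"]) (use cd pd in auto)
  have "is_kernel E i' p'"
    unfolding is_kernel_def
  proof (intro conjI ballI impI)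
    show "i' \<in> arr E" "p' \<in> arr E" "tgt E i' = src E p'" "p' \<cdot> i' = zero_arr E (src E i') (tgt E p')"
      using i' pd by auto
    fix T x assume T: "T \<in> obj E" "x \<in> homs E T (src E p')" "p' \<cdot> x = zero_arr E T (tgt E p')"
    have x: "x \<in> arr E" "src E x = T" "tgt E x = src E p'" using T by (auto simp: homs_iff)
    have "p \<cdot> (f' \<cdot> x) = zero_arr E T (tgt E p)"
      using cmp_eq_extend[OF pd(9), of x] pd x T by auto
    then obtain y where y: "y \<in> arr E" "src E y = T" "tgt E y = src E i" "i \<cdot> y = f' \<cdot> x"
      using kernel_factor[OF k, of "f' \<cdot> x"] pd x by auto
    have e: "f' \<cdot> (i' \<cdot> y) = i \<cdot> y" "p' \<cdot> (i' \<cdot> y) = zero_arr E T (src E f)"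
      using cmp_eq_extend[OF i'(4), of y] cmp_eq_extend[OF i'(5), of y] i' y pd by auto
    show "\<exists>!g. g \<in> homs E T (src E i') \<and> i' \<cdot> g = x"
    proof (intro ex1I[of _ y] conjI)
      show "y \<in> homs E T (src E i')" using y i' by (simp add: homs_iff)
      show "i' \<cdot> y = x"
        by (rule pullback_unique[OF pb]) (use i' y x e T pd in auto)
      fix z assume z: "z \<in> homs E T (src E i') \<and> i' \<cdot> z = x"
      show "z = y"
      proof (rule kernel_mono[OF k])
        show "z \<in> arr E" "y \<in> arr E" "tgt E z = src E i" "tgt E y = src E i" "src E z = src E y"
          using z y i' by (auto simp: homs_iff)
        show "i \<cdot> z = i \<cdot> y"
          using cmp_eq_extend[OF i'(4), of z] i' z y pd by (auto simp: homs_iff)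
      qed
    qed
  qed
  then have "(i', p') \<in> confl E" using confl_of_kernel[OF c0] by simp
  then show ?thesis using that pb i' by blast
qed

text \<open>The pullback of \<open>q\<close> and \<open>x\<close> plays two roles. As a pullback of
  the deflation \<open>q\<close> it is an extension of \<open>src E x\<close> by
  \<open>src E j\<close>. Its other projection \<open>l\<close> is a kernel of
  \<open>y \<cdot> q\<close>, because \<open>y \<cdot> q \<cdot> h = 0\<close> says that
  \<open>q \<cdot> h\<close> factors through \<open>x\<close>.\<close>

lemma noether_confl:
  assumes jq: "(j, q) \<in> confl E" and xy: "(x, y) \<in> confl E" and t: "tgt E q = src E y"
  obtains n m l where "(n, m) \<in> confl E" "src E n = src E j" "tgt E m = src E x" "(l, y \<cdot> q) \<in> confl E"
    "src E l = tgt E n"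
proof -
  note kx = confl_kernel[OF xy] and xd = conflD[OF xy] and jd = conflD[OF jq]
  obtain n m l where c: "(n, m) \<in> confl E" and pb: "is_pullback E q x m l" and n: "src E n = src E j"
    by (rule confl_pullback[OF jq, of x]) (use xd t in auto)
  note pd = pullbackD[OF pb] and nd = conflD[OF c]
  have "is_deflation E (y \<cdot> q)"
    using deflation_cmp[of q y] jq xy t by (auto simp: is_deflation_def)
  then obtain l0 where l0: "(l0, y \<cdot> q) \<in> confl E" by (auto simp: is_deflation_def)
  have "is_kernel E l (y \<cdot> q)"
    unfolding is_kernel_def
  proof (intro conjI ballI impI)
    show "l \<in> arr E" "y \<cdot> q \<in> arr E" "tgt E l = src E (y \<cdot> q)" using pd xd jd t by auto
    show "(y \<cdot> q) \<cdot> l = zero_arr E (src E l) (tgt E (y \<cdot> q))"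
      using cmp_eq_extend[OF xd(4), of m] pd xd jd t by simp
    fix T h assume T: "T \<in> obj E" "h \<in> homs E T (src E (y \<cdot> q))" "(y \<cdot> q) \<cdot> h = zero_arr E T (tgt E (y \<cdot> q))"
    have h: "h \<in> arr E" "src E h = T" "tgt E h = src E q" using T xd jd t by (auto simp: homs_iff)
    have "y \<cdot> (q \<cdot> h) = zero_arr E T (tgt E y)" using T h xd jd t by auto
    then obtain b where b: "b \<in> arr E" "src E b = T" "tgt E b = src E x" "x \<cdot> b = q \<cdot> h"
      using kernel_factor[OF kx, of "q \<cdot> h"] h jd t by auto
    obtain g where g: "g \<in> arr E" "src E g = T" "tgt E g = src E m" "l \<cdot> g = h" "m \<cdot> g = b"
      using pullback_factor[OF pb, of h b] h b by auto
    show "\<exists>!g. g \<in> homs E T (src E l) \<and> l \<cdot> g = h"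
    proof (intro ex1I[of _ g] conjI)
      show "g \<in> homs E T (src E l)" using g pd by (simp add: homs_iff)
      show "l \<cdot> g = h" by (rule g(4))
      fix g' assume g': "g' \<in> homs E T (src E l) \<and> l \<cdot> g' = h"
      show "g' = g"
      proof (rule pullback_unique[OF pb])
        show *: "g' \<in> arr E" "g \<in> arr E" "src E g = src E g'" "tgt E g' = src E m" "tgt E g = src E m"
            "l \<cdot> g' = l \<cdot> g"
          using g g' pd by (auto simp: homs_iff)
        show "m \<cdot> g' = m \<cdot> g"
        proof (rule kernel_mono[OF kx])
          show "x \<cdot> m \<cdot> g' = x \<cdot> m \<cdot> g"
            using cmp_eq_extend[OF pd(9), of g'] * pd g b g' by auto
        qed (use * pd in auto)
      qed
    qed
  qed
  then have "(l, y \<cdot> q) \<in> confl E" using confl_of_kernel[OF l0] by simp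
  then show ?thesis using that[OF c] n pd nd by simp
qed

text \<open>The axioms do not mention products. Replacing the factors of \<open>S\<close> one at a
  time exhibits the product deflation as a composite of two pullbacks, of \<open>p\<close> along
  \<open>s\<close> and then of \<open>p'\<close> along \<open>s' \<cdot> p1\<close>. The middle and
  left terms are then recognised as products by their universal properties.\<close>

lemma confl_product:
  assumes ip: "(i, p) \<in> confl E" and ip': "(i', p') \<in> confl E"
    and S: "is_product S s s'" "tgt E s = tgt E p" "tgt E s' = tgt E p'"
  obtains w d c c' z z' where "(w, d) \<in> confl E" "tgt E d = S"
    "is_product (src E d) c c'" "tgt E c = src E p" "tgt E c' = src E p'"
    "is_product (src E w) z z'" "tgt E z = src E i" "tgt E z' = src E i'"
proof -
  note k = confl_kernel[OF ip] and k' = confl_kernel[OF ip']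
  note pd = conflD[OF ip] and pd' = conflD[OF ip'] and sd = productD[OF S(1)]
  obtain i1 p1 f1 where c1: "(i1, p1) \<in> confl E" and pb1: "is_pullback E p s p1 f1"
    by (rule confl_pullback[OF ip, of s]) (use S sd in auto)
  note b1 = pullbackD[OF pb1]
  obtain i2 p2 f2 where c2: "(i2, p2) \<in> confl E" and pb2: "is_pullback E p' (s' \<cdot> p1) p2 f2"
    by (rule confl_pullback[OF ip', of "s' \<cdot> p1"]) (use S sd b1 in auto)
  note b2 = pullbackD[OF pb2]
  have t: "tgt E p2 = src E p1" "tgt E p1 = S" using b1 b2 sd by auto
  have "is_deflation E (p1 \<cdot> p2)"
    using deflation_cmp[of p2 p1] c1 c2 t by (auto simp: is_deflation_def)
  then obtain w where w: "(w, p1 \<cdot> p2) \<in> confl E" by (auto simp: is_deflation_def)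
  note wk = confl_kernel[OF w] and wd = conflD[OF w]
  \<comment> \<open>The two components in \<open>S\<close> of an arrow through
    \<open>p1 \<cdot> p2\<close>. They reduce equations in \<open>S\<close> to equations for
    \<open>p\<close> and \<open>p'\<close>.\<close>
  have sq1: "s \<cdot> (p1 \<cdot> p2 \<cdot> h) = p \<cdot> (f1 \<cdot> p2 \<cdot> h)" and sq2: "s' \<cdot> (p1 \<cdot> p2 \<cdot> h) = p' \<cdot> (f2 \<cdot> h)"
    if "h \<in> arr E" "tgt E h = src E p2" for h
    using cmp_eq_extend[OF b1(9), of "p2 \<cdot> h"] cmp_eq_extend[OF b2(9), of h] b1 b2 that sd S t by auto
  have C2: "is_product (src E p2) (f1 \<cdot> p2) f2"
  proof (rule productI)
    show "f1 \<cdot> p2 \<in> arr E" "f2 \<in> arr E" "src E (f1 \<cdot> p2) = src E p2" "src E f2 = src E p2"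
      using b1 b2 t by auto
    fix a b assume ab: "a \<in> arr E" "b \<in> arr E" "src E b = src E a" "tgt E a = tgt E (f1 \<cdot> p2)" "tgt E b = tgt E f2"
    then have ab': "tgt E a = src E p" "tgt E b = src E p'" using b1 b2 t by auto
    \<comment> \<open>The pair \<open>(a, b)\<close> determines an arrow into \<open>S\<close>,
      which is lifted to the first pullback using \<open>a\<close> and then to the second using
      \<open>b\<close>.\<close>
    obtain h0 where h0: "h0 \<in> arr E" "src E h0 = src E a" "tgt E h0 = S" "s \<cdot> h0 = p \<cdot> a" "s' \<cdot> h0 = p' \<cdot> b"
      using product_factor[OF S(1), of "p \<cdot> a" "p' \<cdot> b"] ab ab' pd pd' S by auto
    obtain h1 where h1: "h1 \<in> arr E" "src E h1 = src E a" "tgt E h1 = src E p1" "f1 \<cdot> h1 = a" "p1 \<cdot> h1 = h0"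
      using pullback_factor[OF pb1, of a h0] ab ab' h0 sd by auto
    obtain h2 where h2: "h2 \<in> arr E" "src E h2 = src E a" "tgt E h2 = src E p2" "f2 \<cdot> h2 = b" "p2 \<cdot> h2 = h1"
    proof (rule pullback_factor[OF pb2, of b h1])
      show "p' \<cdot> b = (s' \<cdot> p1) \<cdot> h1" using h1 h0 b1 sd t S by simp
    qed (use ab ab' h1 b2 b1 sd t in auto)
    show "\<exists>h. h \<in> arr E \<and> src E h = src E a \<and> tgt E h = src E p2 \<and> (f1 \<cdot> p2) \<cdot> h = a \<and> f2 \<cdot> h = b"
      using h2 h1 b1 b2 t by (intro exI[of _ h2]) auto
  next
    fix h h' assume h: "h \<in> arr E" "h' \<in> arr E" "src E h' = src E h" "tgt E h = src E p2" "tgt E h' = src E p2"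
        "(f1 \<cdot> p2) \<cdot> h = (f1 \<cdot> p2) \<cdot> h'" "f2 \<cdot> h = f2 \<cdot> h'"
    have f: "f1 \<cdot> p2 \<cdot> h = f1 \<cdot> p2 \<cdot> h'" using h b1 b2 t by auto
    have "p1 \<cdot> p2 \<cdot> h = p1 \<cdot> p2 \<cdot> h'"
      by (rule product_unique[OF S(1)]) (use h b1 b2 t sd sq1[of h] sq1[of h'] sq2[of h] sq2[of h'] f in auto)
    then have "p2 \<cdot> h = p2 \<cdot> h'"
      by (intro pullback_unique[OF pb1, of "p2 \<cdot> h" "p2 \<cdot> h'"]) (use h f b2 t in auto)
    then show "h = h'"
      by (intro pullback_unique[OF pb2, of h h']) (use h in auto)
  qed
  note cd = productD[OF C2]
  have wt: "w \<in> arr E" "tgt E w = src E p2" "p1 \<cdot> p2 \<cdot> w = zero_arr E (src E w) S"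
    using wd b1 b2 t by auto
  obtain z where z: "z \<in> arr E" "src E z = src E w" "tgt E z = src E i" "i \<cdot> z = f1 \<cdot> p2 \<cdot> w"
    using kernel_factor[OF k, of "f1 \<cdot> p2 \<cdot> w"] sq1[of w] wt sd b1 b2 t by auto
  obtain z' where z': "z' \<in> arr E" "src E z' = src E w" "tgt E z' = src E i'" "i' \<cdot> z' = f2 \<cdot> w"
    using kernel_factor[OF k', of "f2 \<cdot> w"] sq2[of w] wt sd S b1 b2 t by auto
  have "is_product (src E w) z z'"
  proof (rule productI)
    fix a b assume ab: "a \<in> arr E" "b \<in> arr E" "src E b = src E a" "tgt E a = tgt E z" "tgt E b = tgt E z'"
    obtain h where h: "h \<in> arr E" "src E h = src E a" "tgt E h = src E p2" "(f1 \<cdot> p2) \<cdot> h = i \<cdot> a" "f2 \<cdot> h = i' \<cdot> b"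
      using product_factor[OF C2, of "i \<cdot> a" "i' \<cdot> b"] ab z z' pd pd' b1 b2 t by auto
    have e: "p \<cdot> (i \<cdot> a) = zero_arr E (src E a) (tgt E p)" "p' \<cdot> (i' \<cdot> b) = zero_arr E (src E a) (tgt E p')"
      using cmp_eq_extend[OF pd(4), of a] cmp_eq_extend[OF pd'(4), of b] ab z z' pd pd' by auto
    \<comment> \<open>The components of this arrow in \<open>S\<close> are
      \<open>p \<cdot> i \<cdot> a\<close> and \<open>p' \<cdot> i' \<cdot> b\<close>, both zero, so
      \<open>h\<close> factors through the kernel \<open>w\<close>.\<close>
    have "p1 \<cdot> p2 \<cdot> h = zero_arr E (src E a) S"
      by (rule product_unique[OF S(1)]) (use sq1[of h] sq2[of h] h e b1 b2 t sd S ab in auto)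
    then obtain g where g: "g \<in> arr E" "src E g = src E a" "tgt E g = src E w" "w \<cdot> g = h"
      using kernel_factor[OF wk, of h] h b1 b2 t by auto
    have "i \<cdot> (z \<cdot> g) = i \<cdot> a" "i' \<cdot> (z' \<cdot> g) = i' \<cdot> b"
      using cmp_eq_extend[OF z(4), of g] cmp_eq_extend[OF z'(4), of g] g(1-3) z(1-3) z'(1-3) pd(1) pd'(1) wt(1,2)
        b1(3,4,6,7) b2(3,4,6,7) t g(4) h(1-4) h(5) cd(1-4) by simp_all
    then have "z \<cdot> g = a" "z' \<cdot> g = b"
      using kernel_mono[OF k, of "z \<cdot> g" a] kernel_mono[OF k', of "z' \<cdot> g" b] g(1-3) z(1-3) z'(1-3) ab by simp_all
    then show "\<exists>h. h \<in> arr E \<and> src E h = src E a \<and> tgt E h = src E w \<and> z \<cdot> h = a \<and> z' \<cdot> h = b"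
      using g by auto
  next
    fix h h' assume h: "h \<in> arr E" "h' \<in> arr E" "src E h' = src E h" "tgt E h = src E w" "tgt E h' = src E w"
        "z \<cdot> h = z \<cdot> h'" "z' \<cdot> h = z' \<cdot> h'"
    have "f1 \<cdot> p2 \<cdot> w \<cdot> x = i \<cdot> (z \<cdot> x)" "f2 \<cdot> w \<cdot> x = i' \<cdot> (z' \<cdot> x)" if "x \<in> arr E" "tgt E x = src E w" for x
      using cmp_eq_extend[OF z(4), of x] cmp_eq_extend[OF z'(4), of x] that z(1-3) z'(1-3) pd(1) pd'(1) wt(1,2)
        b1(3,4,6,7) b2(3,4,6,7) t by simp_all
    from this[OF h(1,4)] this[OF h(2,5)] h(6,7)
    have "f1 \<cdot> p2 \<cdot> w \<cdot> h = f1 \<cdot> p2 \<cdot> w \<cdot> h'" "f2 \<cdot> w \<cdot> h = f2 \<cdot> w \<cdot> h'" by simp_all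
    moreover have "w \<cdot> h \<in> arr E" "w \<cdot> h' \<in> arr E" "src E (w \<cdot> h') = src E (w \<cdot> h)"
        "tgt E (w \<cdot> h) = src E p2" "tgt E (w \<cdot> h') = src E p2"
      using h(1-5) wt(1,2) by simp_all
    moreover have "(f1 \<cdot> p2) \<cdot> x = f1 \<cdot> p2 \<cdot> x" if "x \<in> arr E" "tgt E x = src E p2" for x
      using b1(4,7) b2(3) t that by simp
    ultimately have "w \<cdot> h = w \<cdot> h'"
      by (metis product_unique[OF C2])
    then show "h = h'" by (intro kernel_mono[OF wk, of h h']) (use h in auto)
  qed (use z z' in auto)
  then show ?thesis
    using that[OF w, of "f1 \<cdot> p2" f2 z z'] C2 z z' b1 b2 t by auto
qed

end

section \<open>The stable category\<close>

locale syzygy_category = exact_category E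
  for E :: "('o, 'm, 'z) exact_cat_scheme" (structure) +
  fixes Om P :: "'o \<Rightarrow> 'o" and \<iota> \<pi> :: "'o \<Rightarrow> 'm"
  assumes syzygy_choice: "is_syzygy_choice E Om P \<iota> \<pi>"
begin

lemma syzygy:
  assumes "X \<in> obj E"
  shows "is_projective E (P X)" "(\<iota> X, \<pi> X) \<in> confl E" "src E (\<pi> X) = P X" "tgt E (\<pi> X) = X"
    "src E (\<iota> X) = Om X"
  using syzygy_choice assms unfolding is_syzygy_choice_def by (auto simp: homs_iff)

lemma Om_obj [simp]:
  assumes "X \<in> obj E" shows "(Om ^^ n) X \<in> obj E"
proof (induction n)
  case (Suc n)
  then show ?case using syzygy[OF Suc] conflD(1)[of "\<iota> ((Om ^^ n) X)"] src_obj by fastforce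
qed (use assms in simp)

lemma projective_lift:
  assumes "is_projective E Q" "is_deflation E p" "f \<in> arr E" "src E f = Q" "tgt E f = tgt E p"
  obtains g where "g \<in> arr E" "src E g = Q" "tgt E g = src E p" "p \<cdot> g = f"
proof -
  have "\<exists>g \<in> homs E Q (src E p). p \<cdot> g = f"
    using assms unfolding is_projective_def by (simp add: homs_iff)
  then show ?thesis using that by (auto simp: homs_iff)
qed

lemma biproduct_projective:
  assumes b: "is_biproduct S i p j q" and "is_projective E (tgt E p)" "is_projective E (tgt E q)"
  shows "is_projective E S"
  unfolding is_projective_def
proof (intro conjI allI impI)
  note d = b[unfolded is_biproduct_def]
  show S: "S \<in> obj E" using d by auto
  fix r f assume r: "is_deflation E r" and f: "f \<in> homs E S (tgt E r)"
  note rd = deflationD[OF r]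
  have f': "f \<in> arr E" "src E f = S" "tgt E f = tgt E r" using f by (auto simp: homs_iff)
  obtain g where g: "g \<in> arr E" "src E g = tgt E p" "tgt E g = src E r" "r \<cdot> g = f \<cdot> i"
    by (rule projective_lift[OF assms(2) r, of "f \<cdot> i"]) (use f' d in auto)
  obtain h where h: "h \<in> arr E" "src E h = tgt E q" "tgt E h = src E r" "r \<cdot> h = f \<cdot> j"
    by (rule projective_lift[OF assms(3) r, of "f \<cdot> j"]) (use f' d in auto)
  have e: "r \<cdot> g \<cdot> p = f \<cdot> i \<cdot> p" "r \<cdot> h \<cdot> q = f \<cdot> j \<cdot> q"
    using cmp_eq_extend[OF g(4), of p] cmp_eq_extend[OF h(4), of q] g h d rd f' by simp_all
  have "r \<cdot> (g \<cdot> p \<oplus> h \<cdot> q) = r \<cdot> g \<cdot> p \<oplus> r \<cdot> h \<cdot> q"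
    by (rule cmp_add(1)) (use g(1-3) h(1-3) d rd in simp_all)
  also have "\<dots> = f \<cdot> (i \<cdot> p \<oplus> j \<cdot> q)"
    unfolding e by (rule cmp_add(1)[symmetric]) (use d f' in simp_all)
  also have "\<dots> = f" using d f' by simp
  finally show "\<exists>g \<in> homs E S (src E r). r \<cdot> g = f"
    using g(1-3) h(1-3) d by (intro bexI[of _ "g \<cdot> p \<oplus> h \<cdot> q"]) (simp_all add: homs_iff)
qed

section \<open>The ideal of maps factoring through projectives\<close>

lemma proj_idealI:
  assumes "is_projective E Q" "f \<in> arr E" "g \<in> arr E" "tgt E f = Q" "src E g = Q"
  shows "g \<cdot> f \<in> proj_ideal E (src E f) (tgt E g)"
  using assms unfolding proj_ideal_def homs_iff by blast

lemma proj_idealE: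
  assumes "w \<in> proj_ideal E X Y"
  obtains f g where "w = g \<cdot> f" "f \<in> arr E" "g \<in> arr E" "src E g = tgt E f" "is_projective E (tgt E f)"
    "src E f = X" "tgt E g = Y"
  using assms unfolding proj_ideal_def homs_iff by blast

lemma proj_ideal_arr:
  assumes "w \<in> proj_ideal E X Y"
  shows "w \<in> arr E" "src E w = X" "tgt E w = Y"
  using assms by (auto elim!: proj_idealE)

lemma proj_ideal_cmp:
  assumes w: "w \<in> proj_ideal E X Y" and h: "h \<in> arr E"
  shows "src E h = Y \<Longrightarrow> h \<cdot> w \<in> proj_ideal E X (tgt E h)"
    and "tgt E h = X \<Longrightarrow> w \<cdot> h \<in> proj_ideal E (src E h) Y"
proof -
  obtain f g where fg: "w = g \<cdot> f" "f \<in> arr E" "g \<in> arr E" "src E g = tgt E f" "is_projective E (tgt E f)"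
    "src E f = X" "tgt E g = Y"
    using w by (rule proj_idealE)
  show "h \<cdot> w \<in> proj_ideal E X (tgt E h)" if "src E h = Y"
    using proj_idealI[OF fg(5), of f "h \<cdot> g"] fg h that by simp
  show "w \<cdot> h \<in> proj_ideal E (src E h) Y" if "tgt E h = X"
    using proj_idealI[OF fg(5), of "f \<cdot> h" g] fg h that by simp
qed

text \<open>The two projectives may differ. The sum factors through their biproduct, with components
  \<open>f\<close> and \<open>f'\<close> on the way in and \<open>g\<close> and \<open>g'\<close> on
  the way out.\<close>

lemma proj_ideal_add:
  assumes w: "w \<in> proj_ideal E X Y" and w': "w' \<in> proj_ideal E X Y"
  shows "w \<oplus> w' \<in> proj_ideal E X Y"
proof -
  obtain f g where fg: "w = g \<cdot> f" "f \<in> arr E" "g \<in> arr E" "src E g = tgt E f" "is_projective E (tgt E f)"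
    "src E f = X" "tgt E g = Y"
    using w by (rule proj_idealE)
  obtain f' g' where fg': "w' = g' \<cdot> f'" "f' \<in> arr E" "g' \<in> arr E" "src E g' = tgt E f'"
    "is_projective E (tgt E f')" "src E f' = X" "tgt E g' = Y"
    using w' by (rule proj_idealE)
  obtain S i p j q where b: "is_biproduct S i p j q" and pq: "tgt E p = tgt E f" "tgt E q = tgt E f'"
    by (rule biproduct_exists[of "tgt E f" "tgt E f'"]) (use fg(2) fg'(2) in auto)
  note d = b[unfolded is_biproduct_def]
  have S: "is_projective E S"
    using biproduct_projective[OF b] pq fg fg' by simp
  obtain h where h: "h \<in> arr E" "src E h = X" "tgt E h = S" "p \<cdot> h = f" "q \<cdot> h = f'"
    by (rule product_factor[OF biproduct_product[OF b], of f f']) (use fg fg' pq in auto)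
  have e: "(g \<cdot> p) \<cdot> h = w" "(g' \<cdot> q) \<cdot> h = w'"
    using fg fg' d h pq by simp_all
  have "(g \<cdot> p \<oplus> g' \<cdot> q) \<cdot> h = (g \<cdot> p) \<cdot> h \<oplus> (g' \<cdot> q) \<cdot> h"
    by (rule cmp_add(2)) (use fg fg' d h pq in simp_all)
  then have "(g \<cdot> p \<oplus> g' \<cdot> q) \<cdot> h = w \<oplus> w'" using e by simp
  then show ?thesis
    using proj_idealI[OF S, of h "g \<cdot> p \<oplus> g' \<cdot> q"] fg fg' d h pq by simp
qed

lemma proj_ideal_neg:
  assumes w: "w \<in> proj_ideal E X Y"
  shows "neg w \<in> proj_ideal E X Y"
proof -
  obtain f g where fg: "w = g \<cdot> f" "f \<in> arr E" "g \<in> arr E" "src E g = tgt E f" "is_projective E (tgt E f)"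
    "src E f = X" "tgt E g = Y"
    using w by (rule proj_idealE)
  then show ?thesis
    using proj_idealI[OF fg(5), of f "neg g"] cmp_neg(2)[of f g] by simp
qed

lemma proj_ideal_zero:
  assumes "X \<in> obj E" "Y \<in> obj E"
  shows "zero_arr E X Y \<in> proj_ideal E X Y"
proof -
  have Q: "is_projective E (P X)" "P X \<in> obj E"
    using syzygy(1)[OF assms(1)] by (auto simp: is_projective_def)
  show ?thesis
    using proj_idealI[OF Q(1), of "zero_arr E X (P X)" "zero_arr E (P X) Y"] Q assms by simp
qed

lemma proj_ideal_subgroup:
  assumes "X \<in> obj E" "Y \<in> obj E"
  shows "subgroup (proj_ideal E X Y) (hom_group E X Y)"
proof -
  interpret comm_group "hom_group E X Y" by (rule hom_comm_group[OF assms])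
  show ?thesis
  proof
    show "proj_ideal E X Y \<subseteq> carrier (hom_group E X Y)"
      using proj_ideal_arr by (auto simp: hom_group_def homs_iff)
    show "\<one>\<^bsub>hom_group E X Y\<^esub> \<in> proj_ideal E X Y"
      using proj_ideal_zero[OF assms] by (simp add: hom_group_def)
    show "x \<otimes>\<^bsub>hom_group E X Y\<^esub> y \<in> proj_ideal E X Y"
      if "x \<in> proj_ideal E X Y" "y \<in> proj_ideal E X Y" for x y
      using proj_ideal_add that by (simp add: hom_group_def)
    show "inv\<^bsub>hom_group E X Y\<^esub> x \<in> proj_ideal E X Y" if "x \<in> proj_ideal E X Y" for x
      using proj_ideal_neg[OF that] proj_ideal_arr[OF that] by (simp add: neg_def)
  qed
qed

section \<open>Cosets and composition in the stable category\<close>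

lemma stable_class_mem:
  assumes "f \<in> arr E"
  shows "f' \<in> stable_class E f \<longleftrightarrow> (\<exists>w \<in> proj_ideal E (src E f) (tgt E f). f' = w \<oplus> f)"
  unfolding stable_class_def r_coset_def by (auto simp: hom_group_def)

lemma stable_class_eq:
  assumes "f \<in> arr E" "f' \<in> stable_class E f"
  shows "stable_class E f' = stable_class E f" "f' \<in> arr E" "src E f' = src E f" "tgt E f' = tgt E f"
proof -
  obtain w where w: "w \<in> proj_ideal E (src E f) (tgt E f)" "f' = w \<oplus> f"
    using assms stable_class_mem by auto
  then show *: "f' \<in> arr E" "src E f' = src E f" "tgt E f' = tgt E f"
    using proj_ideal_arr[OF w(1)] assms by auto
  interpret comm_group "hom_group E (src E f) (tgt E f)" using hom_comm_group assms by simp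
  show "stable_class E f' = stable_class E f"
    using repr_independence[of f' "proj_ideal E (src E f) (tgt E f)" f] assms *
      proj_ideal_subgroup[of "src E f" "tgt E f"]
    unfolding stable_class_def by (simp add: hom_group_def homs_iff)
qed

lemma stable_class_self:
  assumes "f \<in> arr E"
  shows "f \<in> stable_class E f"
  unfolding stable_class_mem[OF assms]
  using assms proj_ideal_zero[of "src E f" "tgt E f"] by (intro bexI) auto

text \<open>A coset is nonempty and its members share the end points of the representative, so its
  images under \<open>src\<close> and \<open>tgt\<close> are singletons and \<open>the_elem\<close>
  returns the expected objects.\<close>

lemma stable_class_homs:
  assumes "X \<in> obj E" "Y \<in> obj E"
  shows "homs (stable_cat E) X Y = stable_class E ` homs E X Y"
proof -
  have arr: "arr (stable_cat E) = stable_class E ` arr E"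
  proof -
    have "carrier (hom_group E X Y Mod proj_ideal E X Y) = stable_class E ` homs E X Y" for X Y
      unfolding FactGroup_def RCOSETS_def stable_class_def by (auto simp: hom_group_def homs_iff)
    moreover have "arr E = (\<Union>X \<in> obj E. \<Union>Y \<in> obj E. homs E X Y)" by (auto simp: homs_iff)
    ultimately show ?thesis unfolding stable_cat_def by (simp add: image_UN)
  qed
  have "the_elem (src E ` stable_class E f) = src E f" "the_elem (tgt E ` stable_class E f) = tgt E f"
    if f: "f \<in> arr E" for f
  proof -
    have "src E ` stable_class E f = (\<lambda>_. src E f) ` stable_class E f"
      "tgt E ` stable_class E f = (\<lambda>_. tgt E f) ` stable_class E f"
      using stable_class_eq(3,4)[OF f] by (auto intro: image_cong)
    then have "src E ` stable_class E f = {src E f}" "tgt E ` stable_class E f = {tgt E f}"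
      using image_constant[OF stable_class_self[OF f]] by metis+
    then show "the_elem (src E ` stable_class E f) = src E f" "the_elem (tgt E ` stable_class E f) = tgt E f"
      by simp_all
  qed
  then show ?thesis unfolding homs_def arr by (auto simp: stable_cat_def)
qed

text \<open>In \<open>(v \<oplus> g) \<cdot> (w \<oplus> f)\<close> every term except
  \<open>g \<cdot> f\<close> has a factor in the ideal. Hence all the sets in the union that defines
  the composite coincide.\<close>

lemma stable_class_cmp:
  assumes f: "f \<in> arr E" and g: "g \<in> arr E" "src E g = tgt E f"
  shows "stable_class E g \<cdot>\<^bsub>stable_cat E\<^esub> stable_class E f = stable_class E (g \<cdot> f)"
proof -
  have "stable_class E (g' \<cdot> f') = stable_class E (g \<cdot> f)"
    if g': "g' \<in> stable_class E g" and f': "f' \<in> stable_class E f" for g' f'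
  proof -
    obtain w where w: "w \<in> proj_ideal E (src E f) (tgt E f)" "f' = w \<oplus> f"
      using f' stable_class_mem[OF f] by auto
    obtain v where v: "v \<in> proj_ideal E (src E g) (tgt E g)" "g' = v \<oplus> g"
      using g' stable_class_mem[OF g(1)] by auto
    note wa = proj_ideal_arr[OF w(1)] and va = proj_ideal_arr[OF v(1)]
    have "g' \<cdot> f' = v \<cdot> w \<oplus> v \<cdot> f \<oplus> (g \<cdot> w \<oplus> g \<cdot> f)"
      unfolding w(2) v(2)
      using cmp_add(2)[of v g "w \<oplus> f"] cmp_add(1)[of w f v] cmp_add(1)[of w f g] wa va f g by simp
    also have "\<dots> = (v \<cdot> w \<oplus> v \<cdot> f \<oplus> g \<cdot> w) \<oplus> g \<cdot> f"
      using add_assoc[of "v \<cdot> w \<oplus> v \<cdot> f" "g \<cdot> w" "g \<cdot> f"] wa va f g by simp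
    finally have *: "g' \<cdot> f' = (v \<cdot> w \<oplus> v \<cdot> f \<oplus> g \<cdot> w) \<oplus> g \<cdot> f" .
    have "v \<cdot> w \<oplus> v \<cdot> f \<oplus> g \<cdot> w \<in> proj_ideal E (src E f) (tgt E g)"
      using proj_ideal_cmp(2)[OF v(1), of w] proj_ideal_cmp(2)[OF v(1), of f] proj_ideal_cmp(1)[OF w(1), of g]
        wa va f g by (auto intro!: proj_ideal_add)
    then have "g' \<cdot> f' \<in> stable_class E (g \<cdot> f)"
      unfolding stable_class_mem[OF cmp_arr(1)[OF f g]] using * f g by auto
    then show ?thesis using stable_class_eq(1)[OF cmp_arr(1)[OF f g]] by simp
  qed
  then have "stable_class E g \<cdot>\<^bsub>stable_cat E\<^esub> stable_class E f
      = (\<Union>g' \<in> stable_class E g. \<Union>f' \<in> stable_class E f. stable_class E (g \<cdot> f))"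
    by (simp add: stable_cat_def)
  also have "\<dots> = stable_class E (g \<cdot> f)"
  proof -
    have "stable_class E g \<noteq> {}" "stable_class E f \<noteq> {}"
      using stable_class_self[OF f] stable_class_self[OF g(1)] by blast+
    then show ?thesis by simp
  qed
  finally show ?thesis .
qed

text \<open>Removes cosets from the rest of the development: a stable retraction becomes a pair of
  ordinary arrows with an explicit defect \<open>w\<close> in the ideal.\<close>

lemma stable_retract_iff:
  assumes "X \<in> obj E" "Y \<in> obj E"
  shows "stable_retract E X Y \<longleftrightarrow>
    (\<exists>u \<in> homs E X Y. \<exists>v \<in> homs E Y X. \<exists>w \<in> proj_ideal E X X. v \<cdot> u \<oplus> w = ident E X)"
proof -
  have "stable_class E (v \<cdot> u) = stable_class E (ident E X)
      \<longleftrightarrow> (\<exists>w \<in> proj_ideal E X X. v \<cdot> u \<oplus> w = ident E X)"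
    if "u \<in> homs E X Y" "v \<in> homs E Y X" for u v
  proof -
    have uv: "v \<cdot> u \<in> arr E" "src E (v \<cdot> u) = X" "tgt E (v \<cdot> u) = X" using that by (auto simp: homs_iff)
    have "stable_class E (v \<cdot> u) = stable_class E (ident E X) \<longleftrightarrow> ident E X \<in> stable_class E (v \<cdot> u)"
      using stable_class_self[of "ident E X"] stable_class_eq(1)[OF uv(1), of "ident E X"] assms by auto
    also have "\<dots> \<longleftrightarrow> (\<exists>w \<in> proj_ideal E X X. v \<cdot> u \<oplus> w = ident E X)"
      unfolding stable_class_mem[OF uv(1)]
      using uv proj_ideal_arr add_comm[of "v \<cdot> u"] by (intro bex_cong) (auto simp del: cmp_arr)
    finally show ?thesis .
  qed
  moreover have "ident (stable_cat E) X = stable_class E (ident E X)" by (simp add: stable_cat_def)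
  moreover have "stable_class E v \<cdot>\<^bsub>stable_cat E\<^esub> stable_class E u = stable_class E (v \<cdot> u)"
    if "u \<in> homs E X Y" "v \<in> homs E Y X" for u v
    using stable_class_cmp[of u v] that by (simp add: homs_iff)
  ultimately show ?thesis
    unfolding stable_retract_def is_retract_def stable_class_homs[OF assms] stable_class_homs[OF assms(2,1)]
    by simp
qed

lemma stable_retractI:
  assumes "u \<in> arr E" "v \<in> arr E" "src E v = tgt E u" "tgt E v = src E u"
    and "w \<in> proj_ideal E (src E u) (src E u)" "v \<cdot> u \<oplus> w = ident E (src E u)"
  shows "stable_retract E (src E u) (tgt E u)"
proof -
  have "u \<in> homs E (src E u) (tgt E u)" "v \<in> homs E (tgt E u) (src E u)"
    using assms by (simp_all add: homs_iff)
  then show ?thesis using assms stable_retract_iff[of "src E u" "tgt E u"] by auto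
qed

lemma stable_retractE:
  assumes "stable_retract E X Y" "X \<in> obj E" "Y \<in> obj E"
  obtains u v w where "u \<in> arr E" "src E u = X" "tgt E u = Y" "v \<in> arr E" "src E v = Y" "tgt E v = X"
    "w \<in> proj_ideal E X X" "w \<in> arr E" "src E w = X" "tgt E w = X" "v \<cdot> u \<oplus> w = ident E X"
proof -
  obtain u v w where *: "u \<in> homs E X Y" "v \<in> homs E Y X" "w \<in> proj_ideal E X X" "v \<cdot> u \<oplus> w = ident E X"
    using assms(1) unfolding stable_retract_iff[OF assms(2,3)] by blast
  then show ?thesis using that[of u v w] proj_ideal_arr[OF *(3)] by (simp add: homs_iff)
qed

lemma stable_retract_refl:
  assumes X: "X \<in> obj E"
  shows "stable_retract E X X"
  using stable_retractI[of "ident E X" "ident E X" "zero_arr E X X"] proj_ideal_zero[OF X X]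
  by (simp add: X)

text \<open>Inserting \<open>v' \<cdot> u' \<oplus> w'\<close> between \<open>v\<close> and
  \<open>u\<close> shows that the composite retraction has defect
  \<open>v \<cdot> w' \<cdot> u \<oplus> w\<close>, again in the ideal.\<close>

lemma stable_retract_trans:
  assumes XY: "stable_retract E X Y" and YZ: "stable_retract E Y Z"
    and o: "X \<in> obj E" "Y \<in> obj E" "Z \<in> obj E"
  shows "stable_retract E X Z"
proof -
  obtain u v w where u: "u \<in> arr E" "src E u = X" "tgt E u = Y" and v: "v \<in> arr E" "src E v = Y" "tgt E v = X"
    and w: "w \<in> proj_ideal E X X" "w \<in> arr E" "src E w = X" "tgt E w = X" and 1: "v \<cdot> u \<oplus> w = ident E X"
    using XY o(1,2) by (rule stable_retractE)
  obtain u' v' w' where u': "u' \<in> arr E" "src E u' = Y" "tgt E u' = Z" and v': "v' \<in> arr E" "src E v' = Z" "tgt E v' = Y"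
    and w': "w' \<in> proj_ideal E Y Y" "w' \<in> arr E" "src E w' = Y" "tgt E w' = Y" and 2: "v' \<cdot> u' \<oplus> w' = ident E Y"
    using YZ o(2,3) by (rule stable_retractE)
  have m: "v \<cdot> w' \<cdot> u \<in> proj_ideal E X X"
    using proj_ideal_cmp(1)[OF proj_ideal_cmp(2)[OF w'(1) u(1)] v(1)] u v by simp
  have "u = (v' \<cdot> u' \<oplus> w') \<cdot> u" using 2 u by simp
  also have "\<dots> = (v' \<cdot> u') \<cdot> u \<oplus> w' \<cdot> u"
    by (rule cmp_add(2)) (use u u' v' w' in simp_all)
  finally have "v \<cdot> u = v \<cdot> ((v' \<cdot> u') \<cdot> u \<oplus> w' \<cdot> u)" by simp
  also have "\<dots> = v \<cdot> (v' \<cdot> u') \<cdot> u \<oplus> v \<cdot> w' \<cdot> u"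
    by (rule cmp_add(1)) (use u u' v v' w' in simp_all)
  finally have e: "v \<cdot> u = v \<cdot> (v' \<cdot> u') \<cdot> u \<oplus> v \<cdot> w' \<cdot> u" .
  have "(v \<cdot> v') \<cdot> (u' \<cdot> u) \<oplus> (v \<cdot> w' \<cdot> u \<oplus> w) = (v \<cdot> (v' \<cdot> u') \<cdot> u \<oplus> v \<cdot> w' \<cdot> u) \<oplus> w"
    using add_assoc[of "v \<cdot> v' \<cdot> u' \<cdot> u" "v \<cdot> w' \<cdot> u" w] u u' v v' w w' by simp
  also have "\<dots> = ident E X" unfolding e[symmetric] by (rule 1)
  finally show ?thesis
    using stable_retractI[of "u' \<cdot> u" "v \<cdot> v'" "v \<cdot> w' \<cdot> u \<oplus> w"] proj_ideal_add[OF m w(1)] u u' v v' by simp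
qed

lemma stable_retract_product:
  assumes A: "is_product A p q" and B: "is_product B p' q'"
    and r: "stable_retract E (tgt E p) (tgt E p')" "stable_retract E (tgt E q) (tgt E q')"
  shows "stable_retract E A B"
proof -
  note pd = productD[OF A] and pd' = productD[OF B]
  have Ao: "A \<in> obj E" using pd by auto
  obtain i j where "is_biproduct A i p j q" using product_biproduct[OF A] .
  note b = this[unfolded is_biproduct_def]
  obtain u v w where u: "u \<in> arr E" "src E u = tgt E p" "tgt E u = tgt E p'"
    and v: "v \<in> arr E" "src E v = tgt E p'" "tgt E v = tgt E p"
    and w: "w \<in> proj_ideal E (tgt E p) (tgt E p)" "w \<in> arr E" "src E w = tgt E p" "tgt E w = tgt E p"
    and 1: "v \<cdot> u \<oplus> w = ident E (tgt E p)"
    by (rule stable_retractE[OF r(1)]) (use pd pd' in auto)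
  obtain u' v' w' where u': "u' \<in> arr E" "src E u' = tgt E q" "tgt E u' = tgt E q'"
    and v': "v' \<in> arr E" "src E v' = tgt E q'" "tgt E v' = tgt E q"
    and w': "w' \<in> proj_ideal E (tgt E q) (tgt E q)" "w' \<in> arr E" "src E w' = tgt E q" "tgt E w' = tgt E q"
    and 2: "v' \<cdot> u' \<oplus> w' = ident E (tgt E q)"
    by (rule stable_retractE[OF r(2)]) (use pd pd' in auto)
  obtain U where U: "U \<in> arr E" "src E U = A" "tgt E U = B" "p' \<cdot> U = u \<cdot> p" "q' \<cdot> U = u' \<cdot> q"
    by (rule product_factor[OF B, of "u \<cdot> p" "u' \<cdot> q"]) (use u u' pd pd' in auto)
  obtain V where V: "V \<in> arr E" "src E V = B" "tgt E V = A" "p \<cdot> V = v \<cdot> p'" "q \<cdot> V = v' \<cdot> q'"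
    by (rule product_factor[OF A, of "v \<cdot> p'" "v' \<cdot> q'"]) (use v v' pd pd' in auto)
  have ib: "i \<in> arr E" "src E i = tgt E p" "tgt E i = A" "j \<in> arr E" "src E j = tgt E q" "tgt E j = A"
    using b by auto
  \<comment> \<open>The defect is the diagonal arrow with entries \<open>w\<close> and
    \<open>w'\<close>. Written with the injections, it is visibly a sum of members of the
    ideal.\<close>
  let ?W = "i \<cdot> w \<cdot> p \<oplus> j \<cdot> w' \<cdot> q"
  have W: "?W \<in> proj_ideal E A A"
    using proj_ideal_cmp(1)[OF proj_ideal_cmp(2)[OF w(1) pd(1)] ib(1)]
      proj_ideal_cmp(1)[OF proj_ideal_cmp(2)[OF w'(1) pd(2)] ib(4)] ib pd
    by (auto intro!: proj_ideal_add)
  note Wa = proj_ideal_arr[OF W]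
  have s: "p \<cdot> i \<cdot> w \<cdot> p = w \<cdot> p" "p \<cdot> j \<cdot> w' \<cdot> q = zero_arr E A (tgt E p)"
    "q \<cdot> i \<cdot> w \<cdot> p = zero_arr E A (tgt E q)" "q \<cdot> j \<cdot> w' \<cdot> q = w' \<cdot> q"
    using cmp_eq_extend[of p i _ "w \<cdot> p"] cmp_eq_extend[of p j _ "w' \<cdot> q"] cmp_eq_extend[of q i _ "w \<cdot> p"]
      cmp_eq_extend[of q j _ "w' \<cdot> q"] b w w' pd ib
    by simp_all
  have "p \<cdot> ?W = p \<cdot> i \<cdot> w \<cdot> p \<oplus> p \<cdot> j \<cdot> w' \<cdot> q" "q \<cdot> ?W = q \<cdot> i \<cdot> w \<cdot> p \<oplus> q \<cdot> j \<cdot> w' \<cdot> q"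
    by (rule cmp_add(1); use ib w w' pd in simp)+
  then have pW: "p \<cdot> ?W = w \<cdot> p" "q \<cdot> ?W = w' \<cdot> q"
    unfolding s using w w' pd by simp_all
  have pVU: "p \<cdot> V \<cdot> U = v \<cdot> u \<cdot> p" "q \<cdot> V \<cdot> U = v' \<cdot> u' \<cdot> q"
    using cmp_eq_extend[OF V(4), of U] cmp_eq_extend[OF V(5), of U] U V u u' v v' pd pd' by simp_all
  have "V \<cdot> U \<oplus> ?W = ident E A"
  proof (rule product_unique[OF A])
    have "p \<cdot> (V \<cdot> U \<oplus> ?W) = p \<cdot> V \<cdot> U \<oplus> p \<cdot> ?W" by (rule cmp_add(1)) (use U(1-3) V(1-3) Wa pd in simp_all)
    also have "\<dots> = (v \<cdot> u) \<cdot> p \<oplus> w \<cdot> p" unfolding pVU pW using u v pd by simp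
    also have "\<dots> = (v \<cdot> u \<oplus> w) \<cdot> p" by (rule cmp_add(2)[symmetric]) (use u v w pd in simp_all)
    finally show "p \<cdot> (V \<cdot> U \<oplus> ?W) = p \<cdot> ident E A" unfolding 1 using pd by simp
    have "q \<cdot> (V \<cdot> U \<oplus> ?W) = q \<cdot> V \<cdot> U \<oplus> q \<cdot> ?W" by (rule cmp_add(1)) (use U(1-3) V(1-3) Wa pd in simp_all)
    also have "\<dots> = (v' \<cdot> u') \<cdot> q \<oplus> w' \<cdot> q" unfolding pVU pW using u' v' pd by simp
    also have "\<dots> = (v' \<cdot> u' \<oplus> w') \<cdot> q" by (rule cmp_add(2)[symmetric]) (use u' v' w' pd in simp_all)
    finally show "q \<cdot> (V \<cdot> U \<oplus> ?W) = q \<cdot> ident E A" unfolding 2 using pd by simp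
  qed (use U(1-3) V(1-3) Wa Ao in simp_all)
  then show ?thesis
    using stable_retractI[of U V ?W] W U(1-3) V(1-3) by simp
qed

lemma stable_retract_zero:
  assumes "ident E Z = zero_arr E Z Z" "Z \<in> obj E" "Y \<in> obj E"
  shows "stable_retract E Z Y"
  using stable_retractI[of "zero_arr E Z Y" "zero_arr E Y Z" "zero_arr E Z Z"] proj_ideal_zero[of Z Z] assms
  by simp

section \<open>Syzygies\<close>

text \<open>The kernels that arise from Noether's isomorphism and from products of conflations are
  not the chosen \<open>Om X\<close>. This relation admits all of them, and they are compared by
  \<open>stable_retract_syzygy\<close>.\<close>

definition is_syzygy where
  "is_syzygy K X \<longleftrightarrow> (\<exists>i p. (i, p) \<in> confl E \<and> src E i = K \<and> tgt E p = X \<and> is_projective E (src E p))"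

lemma is_syzygyE:
  assumes "is_syzygy K X"
  obtains i p where "(i, p) \<in> confl E" "src E i = K" "tgt E p = X" "is_projective E (src E p)"
  using assms unfolding is_syzygy_def by blast

lemma is_syzygy_obj:
  assumes "is_syzygy K X"
  shows "K \<in> obj E" "X \<in> obj E"
  using assms src_obj tgt_obj conflD(1,2) unfolding is_syzygy_def by blast+

lemma Om_is_syzygy:
  assumes "X \<in> obj E"
  shows "is_syzygy (Om X) X"
  using syzygy[OF assms] unfolding is_syzygy_def by (intro exI[of _ "\<iota> X"] exI[of _ "\<pi> X"]) simp

text \<open>Schanuel's lemma for maps: a retraction modulo projectives lifts to the projective covers, where
  its defect maps to the kernel and hence factors through a projective after restriction.\<close>

lemma stable_retract_syzygy:
  assumes K: "is_syzygy K X" and K': "is_syzygy K' X'" and XX': "stable_retract E X X'"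
  shows "stable_retract E K K'"
proof -
  obtain i p where ip: "(i, p) \<in> confl E" and iK: "src E i = K" and pX: "tgt E p = X" and P: "is_projective E (src E p)"
    using K by (rule is_syzygyE)
  obtain i' p' where ip': "(i', p') \<in> confl E" and iK': "src E i' = K'" and pX': "tgt E p' = X'"
    and P': "is_projective E (src E p')"
    using K' by (rule is_syzygyE)
  note k = confl_kernel[OF ip] and k' = confl_kernel[OF ip']
  note d = conflD[OF ip] and d' = conflD[OF ip']
  note o = is_syzygy_obj[OF K] is_syzygy_obj[OF K']
  have dp: "is_deflation E p" "is_deflation E p'" using ip ip' by (auto simp: is_deflation_def)
  obtain u v w where u: "u \<in> arr E" "src E u = X" "tgt E u = X'" and v: "v \<in> arr E" "src E v = X'" "tgt E v = X"
    and w: "w \<in> proj_ideal E X X" and 1: "v \<cdot> u \<oplus> w = ident E X"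
    using XX' is_syzygy_obj(2)[OF K] is_syzygy_obj(2)[OF K'] by (rule stable_retractE)
  obtain f g where fg: "w = g \<cdot> f" "f \<in> arr E" "g \<in> arr E" "src E g = tgt E f" "is_projective E (tgt E f)"
    "src E f = X" "tgt E g = X"
    using w by (rule proj_idealE)
  obtain U where U: "U \<in> arr E" "src E U = src E p" "tgt E U = src E p'" "p' \<cdot> U = u \<cdot> p"
    by (rule projective_lift[OF P dp(2), of "u \<cdot> p"]) (use u d pX pX' in auto)
  obtain V where V: "V \<in> arr E" "src E V = src E p'" "tgt E V = src E p" "p \<cdot> V = v \<cdot> p'"
    by (rule projective_lift[OF P' dp(1), of "v \<cdot> p'"]) (use v d' pX pX' in auto)
  \<comment> \<open>Lifting only the second half of \<open>w = g \<cdot> f\<close> makes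
    \<open>G \<cdot> f \<cdot> p\<close> a lift of \<open>w \<cdot> p\<close> that still ends in
    \<open>p\<close>, and hence vanishes on the kernel \<open>i\<close>.\<close>
  obtain G where G: "G \<in> arr E" "src E G = tgt E f" "tgt E G = src E p" "p \<cdot> G = g"
    by (rule projective_lift[OF fg(5) dp(1), of g]) (use fg pX in auto)
  have "p' \<cdot> U \<cdot> i = zero_arr E K X'"
    using cmp_eq_extend[OF U(4), of i] U d d' u iK pX o by simp
  then obtain a where a: "a \<in> arr E" "src E a = K" "tgt E a = K'" "i' \<cdot> a = U \<cdot> i"
    using kernel_factor[OF k', of "U \<cdot> i"] U d d' iK iK' pX' by auto
  have "p \<cdot> V \<cdot> i' = zero_arr E K' X"
    using cmp_eq_extend[OF V(4), of i'] V d d' v iK' pX' o by simp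
  then obtain b where b: "b \<in> arr E" "src E b = K'" "tgt E b = K" "i \<cdot> b = V \<cdot> i'"
    using kernel_factor[OF k, of "V \<cdot> i'"] V d d' iK iK' pX by auto
  \<comment> \<open>\<open>e\<close> lies over \<open>v \<cdot> u \<oplus> w = 1\<close>, so
    \<open>1 - e\<close> factors as \<open>i \<cdot> h\<close>. On \<open>K\<close> the correction
    term of \<open>e\<close> vanishes, and \<open>h \<cdot> i\<close> becomes the defect of the
    retraction of kernels.\<close>
  define e where "e = V \<cdot> U \<oplus> G \<cdot> f \<cdot> p"
  have e: "e \<in> arr E" "src E e = src E p" "tgt E e = src E p"
    unfolding e_def using U(1-3) V(1-3) G(1-3) fg(2,6) d pX by simp_all
  have t: "p \<cdot> V \<cdot> U = v \<cdot> u \<cdot> p" "p \<cdot> G \<cdot> f \<cdot> p = g \<cdot> f \<cdot> p"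
    using cmp_eq_extend[OF V(4), of U] cmp_eq_extend[OF G(4), of "f \<cdot> p"] U V G fg(2,3,4,6) u v d d' pX pX' by simp_all
  have "p \<cdot> e = p \<cdot> V \<cdot> U \<oplus> p \<cdot> G \<cdot> f \<cdot> p"
    unfolding e_def by (rule cmp_add(1)) (use U(1-3) V(1-3) G(1-3) fg(2,6) d pX in simp_all)
  also have "\<dots> = (v \<cdot> u) \<cdot> p \<oplus> w \<cdot> p"
    unfolding t fg(1) using u v fg(2-7) d pX by simp
  also have "\<dots> = (v \<cdot> u \<oplus> w) \<cdot> p"
    by (rule cmp_add(2)[symmetric]) (use u v proj_ideal_arr[OF w] d pX in simp_all)
  also have "\<dots> = p" unfolding 1 using d pX by simp
  finally have pe: "p \<cdot> e = p" .
  have "p \<cdot> (ident E (src E p) \<oplus> neg e) = zero_arr E (src E p) (tgt E p)"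
    using cmp_add(1)[of "ident E (src E p)" "neg e" p] cmp_neg(1)[of e p] pe e d by simp
  then obtain h where h: "h \<in> arr E" "src E h = src E p" "tgt E h = K" "i \<cdot> h = ident E (src E p) \<oplus> neg e"
    using kernel_factor[OF k, of "ident E (src E p) \<oplus> neg e"] e d iK by auto
  have "e \<oplus> i \<cdot> h = ident E (src E p)"
    unfolding h(4) by (rule add_add_neg) (use e d in simp_all)
  then have "i = (e \<oplus> i \<cdot> h) \<cdot> i" using d by simp
  also have "\<dots> = e \<cdot> i \<oplus> (i \<cdot> h) \<cdot> i"
    by (rule cmp_add(2)) (use e d h iK in simp_all)
  also have "e \<cdot> i = (V \<cdot> U) \<cdot> i \<oplus> (G \<cdot> f \<cdot> p) \<cdot> i"
    unfolding e_def by (rule cmp_add(2)) (use U(1-3) V(1-3) G(1-3) fg(2,6) d pX in simp_all)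
  also have "(G \<cdot> f \<cdot> p) \<cdot> i = zero_arr E K (src E p)"
    using G(1-3) fg(2,6) d pX iK o by simp
  also have "(V \<cdot> U) \<cdot> i = i \<cdot> b \<cdot> a"
    using cmp_eq_extend[OF b(4), of a] a b U(1-3) V(1-3) d d' iK iK' by simp
  finally have "i = i \<cdot> b \<cdot> a \<oplus> (i \<cdot> h) \<cdot> i"
    using a b d iK by simp
  moreover have "i \<cdot> (b \<cdot> a \<oplus> h \<cdot> i) = i \<cdot> b \<cdot> a \<oplus> i \<cdot> h \<cdot> i"
    by (rule cmp_add(1)) (use a b h(1-3) d iK in simp_all)
  moreover have "(i \<cdot> h) \<cdot> i = i \<cdot> h \<cdot> i" by (rule cmp_assoc_arr) (use h(1-3) d iK in simp_all)
  ultimately have "i \<cdot> (b \<cdot> a \<oplus> h \<cdot> i) = i \<cdot> ident E K" using d iK by simp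
  then have ba: "b \<cdot> a \<oplus> h \<cdot> i = ident E K"
    using kernel_mono[OF k, of "b \<cdot> a \<oplus> h \<cdot> i" "ident E K"] is_syzygy_obj(1)[OF K] a b h(1-3) d iK by simp
  have "h \<cdot> i \<in> proj_ideal E K K"
    using proj_idealI[OF P, of i h] h(1-3) d iK by simp
  then show ?thesis
    using stable_retractI[of a b "h \<cdot> i"] a b ba by simp
qed

lemma Om_stable_retract:
  assumes "stable_retract E X Y" "X \<in> obj E" "Y \<in> obj E"
  shows "stable_retract E ((Om ^^ n) X) ((Om ^^ n) Y)"
proof (induction n)
  case (Suc n)
  then show ?case
    using stable_retract_syzygy[OF Om_is_syzygy Om_is_syzygy] assms by simp
qed (use assms in simp)

text \<open>The chosen cover of a product need not be the product of the chosen covers, so the two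
  syzygies agree only up to stable retracts. Both directions are recorded:
  \<open>k_dell_product\<close> uses one for the object itself and the other for its
  witness.\<close>

lemma Om_pow_product:
  assumes "is_product S s s'"
  obtains T t t' where "is_product T t t'" "tgt E t = (Om ^^ n) (tgt E s)" "tgt E t' = (Om ^^ n) (tgt E s')"
    "stable_retract E ((Om ^^ n) S) T" "stable_retract E T ((Om ^^ n) S)"
proof -
  note sd = productD[OF assms]
  then have So: "S \<in> obj E" by auto
  have "\<exists>T t t'. is_product T t t' \<and> tgt E t = (Om ^^ n) (tgt E s) \<and> tgt E t' = (Om ^^ n) (tgt E s') \<and>
    stable_retract E ((Om ^^ n) S) T \<and> stable_retract E T ((Om ^^ n) S)"
  proof (induction n)
    case 0
    show ?case using assms stable_retract_refl[OF So] by auto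
  next
    case (Suc n)
    then obtain T t t' where T: "is_product T t t'" "tgt E t = (Om ^^ n) (tgt E s)" "tgt E t' = (Om ^^ n) (tgt E s')"
      "stable_retract E ((Om ^^ n) S) T" "stable_retract E T ((Om ^^ n) S)" by blast
    let ?X = "(Om ^^ n) (tgt E s)" and ?X' = "(Om ^^ n) (tgt E s')"
    have o: "?X \<in> obj E" "?X' \<in> obj E" using sd by simp_all
    note X = syzygy[OF o(1)] and X' = syzygy[OF o(2)]
    obtain w d c c' z z' where w: "(w, d) \<in> confl E" "tgt E d = T"
      and c: "is_product (src E d) c c'" "tgt E c = src E (\<pi> ?X)" "tgt E c' = src E (\<pi> ?X')"
      and z: "is_product (src E w) z z'" "tgt E z = src E (\<iota> ?X)" "tgt E z' = src E (\<iota> ?X')"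
      by (rule confl_product[OF X(2) X'(2) T(1)]) (use T X X' in simp_all)
    \<comment> \<open>The middle term is a product of two projectives. The left term
      \<open>src E w\<close> is therefore at once the required product and a syzygy of
      \<open>T\<close>.\<close>
    obtain i j where "is_biproduct (src E d) i c j c'" using product_biproduct[OF c(1)] .
    then have "is_projective E (src E d)"
      using biproduct_projective c(2,3) X(1,3) X'(1,3) by simp
    then have W: "is_syzygy (src E w) T" using w by (auto simp: is_syzygy_def)
    have S: "is_syzygy ((Om ^^ Suc n) S) ((Om ^^ n) S)" using Om_is_syzygy So by simp
    show ?case
      using z X(5) X'(5) stable_retract_syzygy[OF S W T(4)] stable_retract_syzygy[OF W S T(5)]
      by (intro exI[of _ "src E w"] exI[of _ z] exI[of _ z']) simp
  qed
  then show ?thesis using that by blast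
qed

text \<open>Pulling \<open>C \<rightarrow> X\<close> back to syzygies: the syzygy \<open>B\<close> of \<open>X\<close> obtained from \<open>P C \<rightarrow> C \<rightarrow> X\<close> is an extension
  of the kernel \<open>Z\<close> by \<open>Om C\<close>; its pullback along a projective cover of \<open>Z\<close> is a split extension.\<close>

lemma syzygy_confl:
  assumes xy: "(x, y) \<in> confl E" and K: "is_syzygy K (src E x)"
  obtains n m where "(n, m) \<in> confl E" "src E n = K" "is_syzygy (tgt E m) (tgt E y)"
    "stable_retract E (src E m) (Om (src E y))"
proof -
  note xd = conflD[OF xy]
  let ?C = "src E y"
  have C: "?C \<in> obj E" using xd by simp
  note PC = syzygy[OF C]
  obtain a b l where ab: "(a, b) \<in> confl E" "src E a = Om ?C" "tgt E b = src E x"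
    and l: "(l, y \<cdot> \<pi> ?C) \<in> confl E" "src E l = tgt E a"
    using noether_confl[OF PC(2) xy PC(4)] PC(5) by metis
  note ad = conflD[OF ab(1)] and ka = confl_kernel[OF ab(1)] and pd = conflD[OF PC(2)]
  have B: "is_syzygy (src E b) (tgt E y)"
    unfolding is_syzygy_def using l ad PC pd xd by (intro exI[of _ l] exI[of _ "y \<cdot> \<pi> ?C"]) simp
  obtain j q where jq: "(j, q) \<in> confl E" and jK: "src E j = K" and qZ: "tgt E q = src E x"
    and Q: "is_projective E (src E q)"
    using K by (rule is_syzygyE)
  note qd = conflD[OF jq]
  obtain n m f where nm: "(n, m) \<in> confl E" and pb: "is_pullback E q b m f" and n: "src E n = src E j"
    by (rule confl_pullback[OF jq, of b]) (use ad ab qZ in auto)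
  note pbd = pullbackD[OF pb]
  have db: "is_deflation E b" using ab by (auto simp: is_deflation_def)
  \<comment> \<open>Since \<open>src E q\<close> is projective, \<open>q\<close> lifts through
    \<open>b\<close>. The lift gives the section \<open>s\<close> of \<open>f\<close> that splits
    the extension.\<close>
  obtain k where k: "k \<in> arr E" "src E k = src E q" "tgt E k = src E b" "b \<cdot> k = q"
    by (rule projective_lift[OF Q db, of q]) (use qd qZ ab in auto)
  have qo: "src E q \<in> obj E" "src E m \<in> obj E" using qd pbd by simp_all
  have Oo: "Om ?C \<in> obj E" using Om_obj[OF C, of 1] by simp
  obtain s where s: "s \<in> arr E" "src E s = src E q" "tgt E s = src E m" "f \<cdot> s = ident E (src E q)" "m \<cdot> s = k"
    by (rule pullback_factor[OF pb, of "ident E (src E q)" k]) (use qo qd k ad in auto)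
  obtain v where v: "v \<in> arr E" "src E v = Om ?C" "tgt E v = src E m" "m \<cdot> v = a"
    "f \<cdot> v = zero_arr E (Om ?C) (src E q)"
    by (rule pullback_factor[OF pb, of "zero_arr E (src E a) (src E q)" a]) (use qo Oo qd ad ab qZ in auto)
  \<comment> \<open>\<open>m\<close> and \<open>k \<cdot> f\<close> agree after \<open>b\<close>, so
    their difference comes from \<open>Om ?C\<close> by an arrow \<open>u\<close>. The identity then
    decomposes as \<open>v \<cdot> u \<oplus> s \<cdot> f\<close>, whose second term factors through
    a projective.\<close>
  let ?g = "m \<oplus> neg (k \<cdot> f)"
  have g: "?g \<in> arr E" "src E ?g = src E m" "tgt E ?g = src E b"
    using k(1-3) pbd by simp_all
  have bkf: "b \<cdot> k \<cdot> f = q \<cdot> f" using cmp_eq_extend[OF k(4), of f] k(1-3) pbd ad by simp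
  have "b \<cdot> ?g = b \<cdot> m \<oplus> b \<cdot> neg (k \<cdot> f)"
    by (rule cmp_add(1)) (use k(1-3) pbd ad in simp_all)
  also have "b \<cdot> neg (k \<cdot> f) = neg (b \<cdot> m)"
    using cmp_neg(1)[of "k \<cdot> f" b] bkf k(1-3) pbd ad by simp
  finally have "b \<cdot> ?g = zero_arr E (src E m) (tgt E b)"
    using pbd ad by simp
  then obtain u where u: "u \<in> arr E" "src E u = src E m" "tgt E u = Om ?C" "a \<cdot> u = ?g"
    using kernel_factor[OF ka, of ?g] g ab by auto
  have au: "k \<cdot> f \<oplus> a \<cdot> u = m"
    unfolding u(4) by (rule add_add_neg) (use k(1-3) pbd in simp_all)
  have w: "s \<cdot> f \<in> proj_ideal E (src E m) (src E m)"
    using proj_idealI[OF Q, of f s] s(1-3) pbd by simp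
  have "v \<cdot> u \<oplus> s \<cdot> f = ident E (src E m)"
  proof (rule pullback_unique[OF pb])
    have e: "f \<cdot> v \<cdot> u = zero_arr E (src E m) (src E q)" "f \<cdot> s \<cdot> f = f"
      using cmp_eq_extend[OF v(5), of u] cmp_eq_extend[OF s(4), of f] v u(1-3) s(1-3) pbd qo Oo by simp_all
    have "f \<cdot> (v \<cdot> u \<oplus> s \<cdot> f) = f \<cdot> v \<cdot> u \<oplus> f \<cdot> s \<cdot> f"
      by (rule cmp_add(1)) (use u(1-3) v(1-3) s(1-3) pbd in simp_all)
    then show "f \<cdot> (v \<cdot> u \<oplus> s \<cdot> f) = f \<cdot> ident E (src E m)" unfolding e using pbd by simp
    have e': "m \<cdot> v \<cdot> u = a \<cdot> u" "m \<cdot> s \<cdot> f = k \<cdot> f"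
      using cmp_eq_extend[OF v(4), of u] cmp_eq_extend[OF s(5), of f] v u(1-3) s(1-3) pbd by simp_all
    have "m \<cdot> (v \<cdot> u \<oplus> s \<cdot> f) = m \<cdot> v \<cdot> u \<oplus> m \<cdot> s \<cdot> f"
      by (rule cmp_add(1)) (use u(1-3) v(1-3) s(1-3) pbd in simp_all)
    also have "\<dots> = k \<cdot> f \<oplus> a \<cdot> u"
      unfolding e' by (rule add_comm) (use u(1-3) ad ab k(1-3) pbd in simp_all)
    finally show "m \<cdot> (v \<cdot> u \<oplus> s \<cdot> f) = m \<cdot> ident E (src E m)" unfolding au using pbd by simp
  qed (use u(1-3) v(1-3) s(1-3) pbd qo in simp_all)
  then have "stable_retract E (src E m) (Om ?C)"
    using stable_retractI[of u v "s \<cdot> f"] w u(1-3) v(1-3) by simp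
  then show ?thesis
    using that[OF nm] n jK B pbd by simp
qed

section \<open>Delooping levels\<close>

text \<open>Applying \<open>Om\<close> moves a stable retraction one step further with the same
  \<open>Y\<close>. The set in the infimum is thus upward closed, and the bound \<open>m\<close>
  itself can serve as the exponent.\<close>

lemma k_dell_le_iff:
  assumes X: "X \<in> obj E"
  shows "k_dell E Om k X \<le> enat m \<longleftrightarrow> (\<exists>Y \<in> obj E. stable_retract E ((Om ^^ m) X) ((Om ^^ (m + k)) Y))"
proof
  assume "k_dell E Om k X \<le> enat m"
  then obtain n Y where n: "n \<le> m" and Y: "Y \<in> obj E" "stable_retract E ((Om ^^ n) X) ((Om ^^ (n + k)) Y)"
    unfolding k_dell_def Inf_enat_le_iff by blast
  then have "stable_retract E ((Om ^^ (m - n)) ((Om ^^ n) X)) ((Om ^^ (m - n)) ((Om ^^ (n + k)) Y))"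
    using X by (intro Om_stable_retract) simp_all
  moreover have "(Om ^^ (m - n)) ((Om ^^ j) Z) = (Om ^^ (m - n + j)) Z" for j Z
    by (simp add: funpow_add)
  ultimately show "\<exists>Y \<in> obj E. stable_retract E ((Om ^^ m) X) ((Om ^^ (m + k)) Y)"
    using n Y(1) by (intro bexI[of _ Y]) simp_all
qed (auto simp: k_dell_def Inf_enat_le_iff)

lemma k_dell_stable_retract:
  assumes "stable_retract E X X'" "X \<in> obj E" "X' \<in> obj E" "k_dell E Om k X' \<le> enat m"
  shows "k_dell E Om k X \<le> enat m"
proof -
  obtain Y where Y: "Y \<in> obj E" "stable_retract E ((Om ^^ m) X') ((Om ^^ (m + k)) Y)"
    using assms(4) unfolding k_dell_le_iff[OF assms(3)] by blast
  have "stable_retract E ((Om ^^ m) X) ((Om ^^ (m + k)) Y)"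
    by (rule stable_retract_trans[OF Om_stable_retract[OF assms(1-3)] Y(2)]) (use assms Y in simp_all)
  then show ?thesis unfolding k_dell_le_iff[OF assms(2)] using Y(1) by blast
qed

text \<open>One more application of \<open>Om\<close> can be absorbed into the object on the left
  and into \<open>k\<close> on the right, so \<open>k\<close> grows while the bound \<open>m\<close>
  stays. This gain matches the index shift between consecutive terms of a resolution.\<close>

lemma k_dell_syzygy:
  assumes K: "is_syzygy K X" and X: "k_dell E Om k X \<le> enat m"
  shows "k_dell E Om (Suc k) K \<le> enat m"
proof -
  note o = is_syzygy_obj[OF K]
  obtain Y where Y: "Y \<in> obj E" "stable_retract E ((Om ^^ m) X) ((Om ^^ (m + k)) Y)"
    using X o by (auto simp: k_dell_le_iff)
  have "stable_retract E (Om ((Om ^^ m) X)) (Om ((Om ^^ (m + k)) Y))"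
    using Om_stable_retract[OF Y(2), of 1] Y o by simp
  then have "k_dell E Om (Suc k) (Om X) \<le> enat m"
    using Y o Om_obj[OF o(2), of 1] by (auto simp: k_dell_le_iff funpow_swap1)
  moreover have "stable_retract E K (Om X)"
    using stable_retract_syzygy[OF K Om_is_syzygy stable_retract_refl] o by simp
  ultimately show ?thesis
    using k_dell_stable_retract o Om_obj[OF o(2), of 1] by simp
qed

text \<open>The biproduct of the two witnesses is a witness. The given retractions are added between
  the products \<open>T\<close> and \<open>U\<close> of syzygies, which are stably comparable with
  the syzygies of the products.\<close>

lemma k_dell_product:
  assumes S: "is_product S s s'" and k: "k_dell E Om k (tgt E s) \<le> enat m" "k_dell E Om k (tgt E s') \<le> enat m"
  shows "k_dell E Om k S \<le> enat m"
proof -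
  note sd = productD[OF S]
  have o: "tgt E s \<in> obj E" "tgt E s' \<in> obj E" "S \<in> obj E" using sd by auto
  obtain Y where Y: "Y \<in> obj E" "stable_retract E ((Om ^^ m) (tgt E s)) ((Om ^^ (m + k)) Y)"
    using k(1) o by (auto simp: k_dell_le_iff)
  obtain Y' where Y': "Y' \<in> obj E" "stable_retract E ((Om ^^ m) (tgt E s')) ((Om ^^ (m + k)) Y')"
    using k(2) o by (auto simp: k_dell_le_iff)
  obtain Z i p j q where "is_biproduct Z i p j q" and pq: "tgt E p = Y" "tgt E q = Y'"
    using Y(1) Y'(1) by (rule biproduct_exists)
  then have Z: "is_product Z p q" by (auto dest: biproduct_product)
  have Zo: "Z \<in> obj E" using productD[OF Z] by auto
  obtain T t t' where T: "is_product T t t'" "tgt E t = (Om ^^ m) (tgt E s)" "tgt E t' = (Om ^^ m) (tgt E s')"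
    "stable_retract E ((Om ^^ m) S) T"
    using Om_pow_product[OF S] by metis
  obtain U u u' where U: "is_product U u u'" "tgt E u = (Om ^^ (m + k)) Y" "tgt E u' = (Om ^^ (m + k)) Y'"
    "stable_retract E U ((Om ^^ (m + k)) Z)"
    using Om_pow_product[OF Z] pq by metis
  have "T \<in> obj E" "U \<in> obj E" using productD[OF T(1)] productD[OF U(1)] by auto
  moreover have "stable_retract E T U"
    using stable_retract_product[OF T(1) U(1)] T U Y Y' by simp
  ultimately have "stable_retract E ((Om ^^ m) S) ((Om ^^ (m + k)) Z)"
    using stable_retract_trans[OF stable_retract_trans[OF T(4)] U(4)] Zo o by simp
  then show ?thesis using Zo o by (auto simp: k_dell_le_iff)
qed

lemma k_dell_zero:
  assumes "ident E Z = zero_arr E Z Z" and Z: "Z \<in> obj E"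
  shows "k_dell E Om k Z \<le> enat m"
proof -
  have "stable_retract E ((Om ^^ m) Z) ((Om ^^ m) ((Om ^^ k) Z))"
    using assms by (intro Om_stable_retract stable_retract_zero) simp_all
  then show ?thesis using Z by (auto simp: k_dell_le_iff funpow_add)
qed

text \<open>Resolutions of length exactly \<open>m\<close>; by \<open>ddell_bound_pad\<close> shorter ones can be padded with zeros.\<close>

primrec ddell_bound where
  "ddell_bound 0 k X \<longleftrightarrow> k_dell E Om k X \<le> enat 0"
| "ddell_bound (Suc m) k X \<longleftrightarrow> (\<exists>i p. (i, p) \<in> confl E \<and> tgt E p = X \<and>
     k_dell E Om k (src E p) \<le> enat (Suc m) \<and> ddell_bound m (Suc k) (src E i))"

text \<open>In a conflation ending with the identity of \<open>X\<close> the inflation is both zero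
  and monic, so the left term is a zero object. Zero objects satisfy every bound, and the induction
  continues with them.\<close>

lemma ddell_bound_pad:
  assumes "X \<in> obj E" "k_dell E Om k X \<le> enat m"
  shows "ddell_bound m k X"
  using assms
proof (induction m arbitrary: k X)
  case (Suc m)
  obtain i where i: "(i, ident E X) \<in> confl E"
    using ident_deflation[OF Suc.prems(1)] by (auto simp: is_deflation_def)
  note d = conflD[OF i]
  have io: "src E i \<in> obj E" using d by simp
  have "i = zero_arr E (src E i) X" using d Suc.prems(1) by simp
  then have "i \<cdot> ident E (src E i) = i \<cdot> zero_arr E (src E i) (src E i)"
    using d(1,3) Suc.prems(1) io by simp
  then have "ident E (src E i) = zero_arr E (src E i) (src E i)"
    using kernel_mono[OF confl_kernel[OF i], of "ident E (src E i)" "zero_arr E (src E i) (src E i)"] io by simp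
  then have "ddell_bound m (Suc k) (src E i)"
    using Suc.IH k_dell_zero io by simp
  then show ?case using i Suc.prems by (simp, intro exI[of _ i] exI[of _ "ident E X"]) simp
qed simp

text \<open>Having resolutions of equal length is what allows the termwise product. The product of
  the first conflations leaves the product of the left terms to the induction.\<close>

lemma ddell_bound_product:
  assumes "is_product S s s'" "ddell_bound m k (tgt E s)" "ddell_bound m k (tgt E s')"
  shows "ddell_bound m k S"
  using assms
proof (induction m arbitrary: k S s s')
  case 0
  then show ?case using k_dell_product by simp
next
  case (Suc m)
  obtain i p where ip: "(i, p) \<in> confl E" "tgt E p = tgt E s" "k_dell E Om k (src E p) \<le> enat (Suc m)"
    "ddell_bound m (Suc k) (src E i)" using Suc.prems(2) by auto
  obtain i' p' where ip': "(i', p') \<in> confl E" "tgt E p' = tgt E s'" "k_dell E Om k (src E p') \<le> enat (Suc m)"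
    "ddell_bound m (Suc k) (src E i')" using Suc.prems(3) by auto
  obtain w d c c' z z' where w: "(w, d) \<in> confl E" "tgt E d = S"
    and c: "is_product (src E d) c c'" "tgt E c = src E p" "tgt E c' = src E p'"
    and z: "is_product (src E w) z z'" "tgt E z = src E i" "tgt E z' = src E i'"
    by (rule confl_product[OF ip(1) ip'(1) Suc.prems(1)]) (use ip(2) ip'(2) in simp_all)
  have "k_dell E Om k (src E d) \<le> enat (Suc m)" using k_dell_product[OF c(1)] c ip(3) ip'(3) by simp
  moreover have "ddell_bound m (Suc k) (src E w)" using Suc.IH[OF z(1)] z ip(4) ip'(4) by simp
  ultimately show ?case using w by auto
qed

lemma ddell_bound_direct_sum:
  assumes "idempotent_complete E" "is_direct_sum E n (\<lambda>_. X) S inc prj" "ddell_bound m k X"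
  shows "ddell_bound m k S"
  using assms(2)
proof (induction n arbitrary: S inc prj)
  \<comment> \<open>The empty sum is a zero object, because the empty \<open>finprod\<close> is the
    zero arrow.\<close>
  case 0
  then have S: "S \<in> obj E" "ident E S = zero_arr E S S"
    using finprod_hom_0[of S S "\<lambda>j. inc j \<cdot> prj j"] by (simp_all add: is_direct_sum_def)
  then show ?case using ddell_bound_pad k_dell_zero by simp
next
  case (Suc n)
  obtain S' inc' prj' s r where S': "is_direct_sum E n (\<lambda>_. X) S' inc' prj'"
    and b: "is_biproduct S s r (inc n) (prj n)" and t: "tgt E r = S'" "tgt E (prj n) = X"
    using direct_sum_Suc[OF assms(1) Suc.prems] by metis
  show ?case
    using ddell_bound_product[OF biproduct_product[OF b]] Suc.IH[OF S'] t assms(3) by simp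
qed

text \<open>The induction supplies a syzygy of the left term, and \<open>syzygy_confl\<close> turns
  it into a conflation whose right term is a syzygy of \<open>X\<close> and whose middle term is a
  stable retract of the syzygy of the old one. Which syzygy of \<open>X\<close> results is not under
  control, hence the existential form.\<close>

lemma ddell_bound_syzygy:
  assumes "X \<in> obj E" "ddell_bound m k X"
  obtains K where "is_syzygy K X" "ddell_bound m (Suc k) K"
proof -
  have "\<exists>K. is_syzygy K X \<and> ddell_bound m (Suc k) K"
    using assms
  proof (induction m arbitrary: k X)
    case 0
    then show ?case
      using Om_is_syzygy k_dell_syzygy[OF Om_is_syzygy] by (intro exI[of _ "Om X"]) simp
  next
    case (Suc m)
    obtain x y where xy: "(x, y) \<in> confl E" "tgt E y = X" "k_dell E Om k (src E y) \<le> enat (Suc m)"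
      "ddell_bound m (Suc k) (src E x)" using Suc.prems(2) by auto
    note d = conflD[OF xy(1)]
    have o: "src E x \<in> obj E" "src E y \<in> obj E" using d by simp_all
    obtain K where K: "is_syzygy K (src E x)" "ddell_bound m (Suc (Suc k)) K"
      using Suc.IH[OF o(1) xy(4)] by blast
    obtain n l where nl: "(n, l) \<in> confl E" "src E n = K" "is_syzygy (tgt E l) (tgt E y)"
      "stable_retract E (src E l) (Om (src E y))"
      using syzygy_confl[OF xy(1) K(1)] .
    have "k_dell E Om (Suc k) (Om (src E y)) \<le> enat (Suc m)"
      using k_dell_syzygy[OF Om_is_syzygy[OF o(2)] xy(3)] .
    then have "k_dell E Om (Suc k) (src E l) \<le> enat (Suc m)"
      using k_dell_stable_retract[OF nl(4)] conflD(2)[OF nl(1)] Om_obj[OF o(2), of 1] by simp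
    then have "ddell_bound (Suc m) (Suc k) (tgt E l)" using nl K(2) by auto
    then show ?case using nl(3) xy(2) by auto
  qed
  then show ?thesis using that by blast
qed

section \<open>Bounds and admissibly exact sequences\<close>

lemma ddell_bound_admissibly_exact:
  assumes X: "X \<in> obj E" and t: "t \<le> m" and ex: "admissibly_exact E X t C d"
    and le: "\<And>i. i \<le> t \<Longrightarrow> k_dell E Om (i + k) (C i) \<le> enat (m - i)"
  shows "ddell_bound m k X"
proof (cases "t = 0")
  case True
  then have d: "d 0 \<in> arr E" "src E (d 0) = C 0" "tgt E (d 0) = X" "is_iso E (d 0)"
    using ex by (auto simp: admissibly_exact_def homs_iff)
  then obtain g where g: "g \<in> arr E" "src E g = X" "tgt E g = C 0" "d 0 \<cdot> g = ident E X"
    by (auto simp: is_iso_def homs_iff)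
  have "stable_retract E X (C 0)"
    using stable_retractI[of g "d 0" "zero_arr E X X"] proj_ideal_zero[OF X X] d g X by simp
  moreover have "C 0 \<in> obj E" using tgt_obj[OF g(1)] g(3) by simp
  ultimately show ?thesis
    using k_dell_stable_retract X le[of 0] ddell_bound_pad by simp
next
  case False
  then obtain Z a b where Z: "Z 0 = X" "Z t = C t"
    and ab: "\<And>i. i < t \<Longrightarrow> a i \<in> homs E (Z (i + 1)) (C i) \<and> b i \<in> homs E (C i) (Z i) \<and> (a i, b i) \<in> confl E"
    using ex by (auto simp: admissibly_exact_def)
  obtain t' where t': "t = Suc t'" using False by (cases t) auto
  have "Z t \<in> obj E" using ab[of t'] t' src_obj[of "a t'"] by (simp add: homs_iff)
  \<comment> \<open>Descending induction along the spliced objects, starting at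
    \<open>Z t = C t\<close>, where the remaining length \<open>m - t\<close> is filled by
    padding.\<close>
  have "ddell_bound (m - i) (i + k) (Z i)" if "i \<le> t" for i
    using that
  proof (induction rule: inc_induct)
    case base
    then show ?case using Z(2) le[of t] \<open>Z t \<in> obj E\<close> ddell_bound_pad by simp
  next
    case (step i)
    have "m - i = Suc (m - Suc i)" using step t by simp
    then show ?case
      using step.IH le[of i] ab[of i] step.hyps
      by (simp add: homs_iff) (rule exI[of _ "a i"], rule exI[of _ "b i"], simp)
  qed
  from this[of 0] show ?thesis using Z by simp
qed

lemma ddell_bound_resolution:
  assumes "ddell_bound m k X"
  shows "\<exists>C Z a b. Z 0 = X \<and> Z m = C m \<and>
    (\<forall>i<m. a i \<in> homs E (Z (i + 1)) (C i) \<and> b i \<in> homs E (C i) (Z i) \<and> (a i, b i) \<in> confl E) \<and>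
    (\<forall>i\<le>m. k_dell E Om (i + k) (C i) \<le> enat (m - i))"
  using assms
proof (induction m arbitrary: k X)
  case 0
  then show ?case by (intro exI[of _ "\<lambda>_. X"]) auto
next
  case (Suc m)
  obtain i p where ip: "(i, p) \<in> confl E" "tgt E p = X" "k_dell E Om k (src E p) \<le> enat (Suc m)"
    "ddell_bound m (Suc k) (src E i)" using Suc.prems by auto
  obtain C Z a b where IH: "Z 0 = src E i" "Z m = C m"
    "\<forall>i<m. a i \<in> homs E (Z (i + 1)) (C i) \<and> b i \<in> homs E (C i) (Z i) \<and> (a i, b i) \<in> confl E"
    "\<forall>i\<le>m. k_dell E Om (i + Suc k) (C i) \<le> enat (m - i)"
    using Suc.IH[OF ip(4)] by blast
  note d = conflD[OF ip(1)]
  show ?case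
    \<comment> \<open>\<open>case_nat\<close> puts the new conflation in front and shifts the
      inductive resolution by one index, which turns \<open>i + Suc k\<close> into
      \<open>Suc i + k\<close>.\<close>
    by (rule exI[of _ "case_nat (src E p) C"], rule exI[of _ "case_nat X Z"],
        rule exI[of _ "case_nat i a"], rule exI[of _ "case_nat p b"])
      (use IH ip d in \<open>auto simp: homs_iff split: nat.splits\<close>)
qed

lemma k_ddell_le_iff:
  assumes X: "X \<in> obj E"
  shows "k_ddell E Om k X \<le> enat m \<longleftrightarrow> ddell_bound m k X"
proof
  assume "k_ddell E Om k X \<le> enat m"
  then obtain n t C d where n: "n \<le> m" "t \<le> n" and ex: "admissibly_exact E X t C d"
    and le: "\<forall>i\<le>t. k_dell E Om (i + k) (C i) \<le> enat (n - i)"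
    unfolding k_ddell_def Inf_enat_le_iff by blast
  show "ddell_bound m k X"
  proof (rule ddell_bound_admissibly_exact[OF X _ ex])
    show "k_dell E Om (i + k) (C i) \<le> enat (m - i)" if "i \<le> t" for i
      using le that n(1) by (meson diff_le_mono enat_ord_simps(1) order_trans)
  qed (use n in simp)
next
  assume "ddell_bound m k X"
  then obtain C Z a b where Z: "Z 0 = X" "Z m = C m"
    and ab: "\<forall>i<m. a i \<in> homs E (Z (i + 1)) (C i) \<and> b i \<in> homs E (C i) (Z i) \<and> (a i, b i) \<in> confl E"
    and le: "\<forall>i\<le>m. k_dell E Om (i + k) (C i) \<le> enat (m - i)"
    using ddell_bound_resolution by blast
  \<comment> \<open>The differentials are the composites across the splices. Length zero is
    separate, since an isomorphism onto \<open>X\<close> is then required; it is the identity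
    because \<open>C 0 = Z 0 = X\<close>.\<close>
  define d where "d i = (if m = 0 then ident E X else if i = 0 then b 0
    else if i < m then a (i - 1) \<cdot> b i else a (m - 1))" for i
  have "admissibly_exact E X m C d"
  proof (cases "m = 0")
    case True
    then show ?thesis
      using Z X unfolding admissibly_exact_def d_def is_iso_def
      by (auto simp: homs_iff intro!: bexI[of _ "ident E X"])
  next
    case False
    show ?thesis
      unfolding admissibly_exact_def d_def if_not_P[OF False]
      by (rule exI[of _ Z], rule exI[of _ a], rule exI[of _ b]) (use Z ab False in simp)
  qed
  then show "k_ddell E Om k X \<le> enat m"
    unfolding k_ddell_def Inf_enat_le_iff using le by blast
qed

section \<open>The upper bound\<close>

lemma ddell_bound_cogenerated:
  assumes "idempotent_complete E" "finite_sum_admissible_cogenerator E I" "ddell_bound m 1 I" "X \<in> obj E"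
  shows "ddell_bound (Suc m) 1 X"
proof -
  obtain r S inc prj x where S: "is_direct_sum E r (\<lambda>_. I) S inc prj" and x: "x \<in> homs E X S" "is_inflation E x"
    using assms(2,4) unfolding finite_sum_admissible_cogenerator_def by blast
  obtain y where xy: "(x, y) \<in> confl E" using x(2) by (auto simp: is_inflation_def)
  have xd: "src E x = X" "tgt E x = S" "src E y = S" "S \<in> obj E" "y \<in> arr E"
    using x(1) conflD[OF xy] by (auto simp: homs_iff)
  \<comment> \<open>Passing to the syzygy raises the index to \<open>Suc 1\<close>, exactly what
    \<open>ddell_bound (Suc m) 1\<close> demands of the left term of the first conflation.\<close>
  obtain K where K: "is_syzygy K S" "ddell_bound m (Suc 1) K"
    using ddell_bound_syzygy[OF xd(4) ddell_bound_direct_sum[OF assms(1) S assms(3)]] .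
  obtain j q where jq: "(j, q) \<in> confl E" "src E j = K" "tgt E q = S" "is_projective E (src E q)"
    using K(1) by (rule is_syzygyE)
  obtain n l h where n: "(n, l) \<in> confl E" "src E n = src E j" "tgt E l = src E x"
    and h: "(h, y \<cdot> q) \<in> confl E" "src E h = tgt E n"
    by (rule noether_confl[OF jq(1) xy]) (use jq xd in simp_all)
  note qd = conflD(2)[OF jq(1)] and nd = conflD[OF n(1)]
  have Yo: "tgt E y \<in> obj E" using xd by simp
  have L: "is_syzygy (src E l) (tgt E y)"
    unfolding is_syzygy_def using h jq xd qd nd by (intro exI[of _ h] exI[of _ "y \<cdot> q"]) simp
  \<comment> \<open>For \<open>k = 0\<close> every object is its own witness. The bound is taken to
    be \<open>Suc m\<close>, the value allowed for the first term, and one syzygy raises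
    \<open>k\<close> to 1.\<close>
  have "k_dell E Om 0 (tgt E y) \<le> enat (Suc m)"
    unfolding k_dell_le_iff[OF Yo] using stable_retract_refl[OF Om_obj[OF Yo, of "Suc m"]] Yo
    by (intro bexI[of _ "tgt E y"]) simp_all
  then have "k_dell E Om 1 (src E l) \<le> enat (Suc m)"
    using k_dell_syzygy[OF L] by simp
  then show ?thesis using n jq(2) K(2) xd(1) by auto
qed

lemma ddell_le_iff: "X \<in> obj E \<Longrightarrow> ddell E Om X \<le> enat m \<longleftrightarrow> ddell_bound m 1 X"
  by (simp add: ddell_def k_ddell_le_iff)

lemma gddell_le_ddell_cogenerator:
  assumes "idempotent_complete E" and I: "finite_sum_admissible_cogenerator E I"
  shows "gddell E Om \<le> ddell E Om I + 1"
proof (cases "ddell E Om I")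
  case (enat m)
  have "I \<in> obj E" using I by (simp add: finite_sum_admissible_cogenerator_def)
  then have "ddell_bound m 1 I" using enat ddell_le_iff[of I m] by simp
  then have "ddell E Om X \<le> enat (Suc m)" if "X \<in> obj E" for X
    using ddell_bound_cogenerated[OF assms] ddell_le_iff that by simp
  then show ?thesis
    unfolding gddell_def enat by (auto intro!: SUP_least simp: one_enat_def)
qed simp

end

theorem theorem4p14:
  fixes E :: "('o, 'm, 'z) exact_cat_scheme"
    and Om P :: "'o \<Rightarrow> 'o" and \<iota> \<pi> :: "'o \<Rightarrow> 'm" and I :: 'o
  assumes "exact_category E"
    and "idempotent_complete E"
    and "enough_projectives E"
    and "is_syzygy_choice E Om P \<iota> \<pi>"
    and "finite_sum_admissible_cogenerator E I"
  shows "ddell E Om I \<le> gddell E Om \<and> gddell E Om \<le> ddell E Om I + 1 \<and>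
    (ddell E Om I < \<infinity> \<longleftrightarrow> gddell E Om < \<infinity>) \<and>
    (gddell E Om < \<infinity> \<longleftrightarrow> Fddell E Om = obj E)"
proof -
  interpret syzygy_category E Om P \<iota> \<pi>
    using assms(1,4) by (simp add: syzygy_category_def syzygy_category_axioms_def)
  have I: "I \<in> obj E" using assms(5) by (simp add: finite_sum_admissible_cogenerator_def)
  have le: "ddell E Om X \<le> gddell E Om" if "X \<in> obj E" for X
    unfolding gddell_def using that by (rule SUP_upper)
  have ge: "gddell E Om \<le> ddell E Om I + 1"
    using gddell_le_ddell_cogenerator assms(2,5) by simp
  have "gddell E Om < \<infinity>" if fin: "ddell E Om I < \<infinity>"
  proof -
    obtain m where "ddell E Om I = enat m" using fin by (cases "ddell E Om I") auto
    then have "gddell E Om \<le> enat (m + 1)" using ge by (simp add: one_enat_def)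
    then show ?thesis by (rule le_less_trans) simp
  qed
  moreover have "ddell E Om X < \<infinity>" if "gddell E Om < \<infinity>" "X \<in> obj E" for X
    using le[OF that(2)] that(1) by (rule le_less_trans)
  \<comment> \<open>The cycle of implications closes at \<open>I\<close>: if all levels are finite,
    so is that of \<open>I\<close>, and then the supremum is finite by \<open>ge\<close>.\<close>
  ultimately show ?thesis
    using le[OF I] ge I unfolding Fddell_def by blast
qed

end
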